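(* The set $\mathcal G_{\mu,\nu}\subset(0,\infty)^2$ of parameter values $(\mu,\nu)$ satisfying $$C_4-C_3-\gamma\,(C_1-C_2)\,\mathbb 1\{C_1>C_2\}>0$$ is not empty. Consequently, if $(\mu,\nu)\in\mathcal G_{\mu,\nu}$, then the linearized entropy $\mathrm E[\mathbf w]=\sum_{n\in\mathbb Z}\frac{w_n^2}{p_n^*}$ decreases exponentially fast in time along solutions of the linearized system: there is a constant $\kappa>0$ depending only on $(\mu,\nu)$ such that every solution $\mathbf w(t)$, $t\ge0$, of $\frac{\mathrm d}{\mathrm dt}\mathbf w=\mathcal L[\mathbf w]$ with $\mathbf w(t)\in V$ for all $t$ satisfies $\mathrm E[\mathbf w(t)]\le \mathrm E[\mathbf w(0)]\,e^{-\kappa t}$ for all $t\ge0$.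
   Context: For $\mu,\nu>0$ define $p_0^*=\frac{1}{4\nu+2}$ if $\mu=1$ and $p_0^*=\frac{\mu(\nu+\frac12)-\sqrt{\mu^2\nu^2+\mu^2\nu+\frac14}}{(\mu^2-1)/2}$ if $\mu\ne1$; $r^*=\frac{(\mu-1)p_0^*+1}{2}$; $d^*=1-p_0^*-r^*$; and the two-sided geometric distribution $$p_n^*=\left(\frac{r^*}{r^*+p_0^*}\right)^n p_0^*\ (n\ge0),\qquad p_n^*=\left(\frac{d^*}{d^*+p_0^*}\right)^{-n}p_0^*\ (n\le0).$$ Linearized system. For $\mathbf w=\{w_n\}_{n\in\mathbb Z}$ put $$\alpha=\frac{\sum_{n\ge1}w_n}{r^*}-\frac{\sum_{n\ge0}w_n}{r^*+p_0^*},\qquad \beta=\frac{\sum_{n\le-1}w_n}{d^*}-\frac{\sum_{n\le0}w_n}{d^*+p_0^*}.$$ The operator $\mathcal L$ is given as follows. For $n\ge1$: $$\mathcal L[\mathbf w]_n=w_{n+1}-w_n+\frac{r^*}{r^*+p_0^*}(w_{n-1}-w_n)+\alpha\frac{r^*}{r^*+p_0^*}(p_{n-1}^*-p_n^* ).$$ For $n=0$: $$\mathcal L[\mathbf w]_0=w_1+\frac{r^*}{r^*+p_0^*}(w_{-1}-w_0)+\alpha\frac{r^*}{r^*+p_0^*}(p_{-1}^*-p_0^* )-\left(w_0+(\alpha+\beta)p_0^*\right)\frac{r^*d^*}{(r^*+p_0^* )(d^*+p_0^* )}.$$ For $n\le-1$: $$\mathcal L[\mathbf w]_n=\frac{r^*d^*}{(r^*+p_0^*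 )(d^*+p_0^* )}(w_{n+1}-w_n)+\frac{r^*}{r^*+p_0^*}(w_{n-1}-w_n)+\alpha\frac{r^*}{r^*+p_0^*}(p_{n-1}^*-p_n^* )+\frac{r^*d^*(\alpha+\beta)(p_{n+1}^*-p_n^* )}{(r^*+p_0^* )(d^*+p_0^* )}.$$ Solutions live in $$V=\Big\{\mathbf w\in\ell^1(\mathbb Z)\ :\ \sum_{n\in\mathbb Z}w_n=0,\ \sum_{n\in\mathbb Z}n\,w_n=0,\ \sum_{n\le0}n\,w_n=0\Big\}.$$ Constants (functions of $(\mu,\nu)$ through $r^*,d^*,p_0^*$): $$C_1=1-\frac{r^*d^*}{(r^*+p_0^* )(d^*+p_0^* )}-\frac{r^*}{2r^*+p_0^*}-\frac{r^*(d^* )^2}{(2d^*+p_0^* )(r^*+p_0^* )^2}-\frac{r^*d^*}{(r^*+p_0^* )(2d^*+p_0^* )}-\frac{(r^* )^3d^*}{(r^*+p_0^* )(2r^*+p_0^* )(d^*+p_0^* )^2},$$ $$C_2=\max\left\{\left(\frac{\sqrt{r^*+p_0^*}-\sqrt{r^*}}{\sqrt{r^*+p_0^*}}\right)^2,\ \frac{r^*}{r^*+p_0^*}\left(\frac{\sqrt{d^*+p_0^*}-\sqrt{d^*}}{\sqrt{d^*+p_0^*}}\right)^2\right\},$$ $$C_3=\frac{r^*}{2r^*+p_0^*}+\frac{r^*(d^* )^2}{(2d^*+p_0^* )(r^*+p_0^* )^2}+\frac{r^*d^*}{(r^*+p_0^* )(2d^*+p_0^* )}+\frac{(r^* )^3d^*}{(r^*+p_0^*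 )(2r^*+p_0^* )(d^*+p_0^* )^2},$$ $$C_4=\min\left\{\left(\frac{\sqrt{r^*+p_0^*}-\sqrt{r^*}}{\sqrt{r^*+p_0^*}}\right)^2,\ \frac{r^*}{r^*+p_0^*}\left(\frac{\sqrt{d^*+p_0^*}-\sqrt{d^*}}{\sqrt{d^*+p_0^*}}\right)^2\right\},$$ $$\gamma=\frac{\frac{(r^* )^2}{2r^*+p_0^*}+\frac{(d^* )^2}{2d^*+p_0^*}}{p_0^*+\frac{(r^* )^2}{2r^*+p_0^*}+\frac{(d^* )^2}{2d^*+p_0^*}}.$$ Here $\mathbb 1\{C_1>C_2\}$ equals $1$ if $C_1>C_2$ and $0$ otherwise. *)

theory Defs
  imports "HOL-Analysis.Analysis"
begin

definition p0star :: "real \<Rightarrow> real \<Rightarrow> real" where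
  "p0star \<mu> \<nu> =
     (if \<mu> = 1 then 1 / (4 * \<nu> + 2)
      else (\<mu> * (\<nu> + 1/2) - sqrt (\<mu>\<^sup>2 * \<nu>\<^sup>2 + \<mu>\<^sup>2 * \<nu> + 1/4)) / ((\<mu>\<^sup>2 - 1) / 2))"

definition rstar :: "real \<Rightarrow> real \<Rightarrow> real" where
  "rstar \<mu> \<nu> = ((\<mu> - 1) * p0star \<mu> \<nu> + 1) / 2"

definition dstar :: "real \<Rightarrow> real \<Rightarrow> real" where
  "dstar \<mu> \<nu> = 1 - p0star \<mu> \<nu> - rstar \<mu> \<nu>"

definition pstar :: "real \<Rightarrow> real \<Rightarrow> int \<Rightarrow> real" where
  "pstar \<mu> \<nu> n =
     (let p0 = p0star \<mu> \<nu>; r = rstar \<mu> \<nu>; d = dstar \<mu> \<nu> in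
      if n \<ge> 0 then (r / (r + p0)) powi n * p0
      else (d / (d + p0)) powi (- n) * p0)"

(* The sums below are only used for absolutely summable w, so no unsummable
   (default-zero) case of infsum arises. *)
definition lin_alpha :: "real \<Rightarrow> real \<Rightarrow> (int \<Rightarrow> real) \<Rightarrow> real" where
  "lin_alpha \<mu> \<nu> w =
     (\<Sum>\<^sub>\<infinity>n\<in>{1..}. w n) / rstar \<mu> \<nu>
     - (\<Sum>\<^sub>\<infinity>n\<in>{0..}. w n) / (rstar \<mu> \<nu> + p0star \<mu> \<nu>)"

definition lin_beta :: "real \<Rightarrow> real \<Rightarrow> (int \<Rightarrow> real) \<Rightarrow> real" where
  "lin_beta \<mu> \<nu> w =
     (\<Sum>\<^sub>\<infinity>n\<in>{..-1}. w n) / dstar \<mu> \<nu>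
     - (\<Sum>\<^sub>\<infinity>n\<in>{..0}. w n) / (dstar \<mu> \<nu> + p0star \<mu> \<nu>)"

definition lin_op :: "real \<Rightarrow> real \<Rightarrow> (int \<Rightarrow> real) \<Rightarrow> int \<Rightarrow> real" where
  "lin_op \<mu> \<nu> w n =
     (let p0 = p0star \<mu> \<nu>; r = rstar \<mu> \<nu>; d = dstar \<mu> \<nu>; p = pstar \<mu> \<nu>;
          \<alpha> = lin_alpha \<mu> \<nu> w; \<beta> = lin_beta \<mu> \<nu> w in
      if n \<ge> 1 then
        w (n + 1) - w n + r / (r + p0) * (w (n - 1) - w n)
        + \<alpha> * (r / (r + p0)) * (p (n - 1) - p n)
      else if n = 0 then
        w 1 + r / (r + p0) * (w (-1) - w 0)
        + \<alpha> * (r / (r + p0)) * (p (-1) - p0)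
        - (w 0 + (\<alpha> + \<beta>) * p0) * (r * d / ((r + p0) * (d + p0)))
      else
        r * d / ((r + p0) * (d + p0)) * (w (n + 1) - w n)
        + r / (r + p0) * (w (n - 1) - w n)
        + \<alpha> * (r / (r + p0)) * (p (n - 1) - p n)
        + r * d * (\<alpha> + \<beta>) * (p (n + 1) - p n) / ((r + p0) * (d + p0)))"

(* Using has_sum rather than infsum makes convergence of the first-moment
   series part of membership. *)
definition V_space :: "(int \<Rightarrow> real) set" where
  "V_space = {w. (\<lambda>n. \<bar>w n\<bar>) summable_on UNIV
                \<and> (w has_sum 0) UNIV
                \<and> ((\<lambda>n. of_int n * w n) has_sum 0) UNIV
                \<and> ((\<lambda>n. of_int n * w n) has_sum 0) {..0}}"

(* Componentwise derivatives, one-sided at t = 0. *)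
definition lin_solution :: "real \<Rightarrow> real \<Rightarrow> (real \<Rightarrow> int \<Rightarrow> real) \<Rightarrow> bool" where
  "lin_solution \<mu> \<nu> w \<longleftrightarrow>
     (\<forall>t\<ge>0. w t \<in> V_space) \<and>
     (\<forall>t\<ge>0. \<forall>n. ((\<lambda>s. w s n) has_real_derivative lin_op \<mu> \<nu> (w t) n) (at t within {0..}))"

(* Valued in [0, \<infinity>], since the entropy of an element of V_space may be infinite. *)
definition lin_entropy :: "real \<Rightarrow> real \<Rightarrow> (int \<Rightarrow> real) \<Rightarrow> ennreal" where
  "lin_entropy \<mu> \<nu> w = (\<Sum>\<^sub>\<infinity>n\<in>UNIV. ennreal ((w n)\<^sup>2 / pstar \<mu> \<nu> n))"

definition C1 :: "real \<Rightarrow> real \<Rightarrow> real" where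
  "C1 \<mu> \<nu> =
     (let p0 = p0star \<mu> \<nu>; r = rstar \<mu> \<nu>; d = dstar \<mu> \<nu> in
      1 - r * d / ((r + p0) * (d + p0))
        - r / (2 * r + p0)
        - r * d^2 / ((2 * d + p0) * (r + p0)^2)
        - r * d / ((r + p0) * (2 * d + p0))
        - r^3 * d / ((r + p0) * (2 * r + p0) * (d + p0)^2))"

definition C2 :: "real \<Rightarrow> real \<Rightarrow> real" where
  "C2 \<mu> \<nu> =
     (let p0 = p0star \<mu> \<nu>; r = rstar \<mu> \<nu>; d = dstar \<mu> \<nu> in
      max (((sqrt (r + p0) - sqrt r) / sqrt (r + p0))^2)
          (r / (r + p0) * ((sqrt (d + p0) - sqrt d) / sqrt (d + p0))^2))"

definition C3 :: "real \<Rightarrow> real \<Rightarrow> real" where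
  "C3 \<mu> \<nu> =
     (let p0 = p0star \<mu> \<nu>; r = rstar \<mu> \<nu>; d = dstar \<mu> \<nu> in
      r / (2 * r + p0)
      + r * d^2 / ((2 * d + p0) * (r + p0)^2)
      + r * d / ((r + p0) * (2 * d + p0))
      + r^3 * d / ((r + p0) * (2 * r + p0) * (d + p0)^2))"

definition C4 :: "real \<Rightarrow> real \<Rightarrow> real" where
  "C4 \<mu> \<nu> =
     (let p0 = p0star \<mu> \<nu>; r = rstar \<mu> \<nu>; d = dstar \<mu> \<nu> in
      min (((sqrt (r + p0) - sqrt r) / sqrt (r + p0))^2)
          (r / (r + p0) * ((sqrt (d + p0) - sqrt d) / sqrt (d + p0))^2))"

definition gamma_const :: "real \<Rightarrow> real \<Rightarrow> real" where
  "gamma_const \<mu> \<nu> =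
     (let p0 = p0star \<mu> \<nu>; r = rstar \<mu> \<nu>; d = dstar \<mu> \<nu> in
      (r^2 / (2 * r + p0) + d^2 / (2 * d + p0))
      / (p0 + r^2 / (2 * r + p0) + d^2 / (2 * d + p0)))"

definition G_set :: "(real \<times> real) set" where
  "G_set = {(\<mu>, \<nu>). \<mu> > 0 \<and> \<nu> > 0 \<and>
     C4 \<mu> \<nu> - C3 \<mu> \<nu>
       - gamma_const \<mu> \<nu> * (C1 \<mu> \<nu> - C2 \<mu> \<nu>) * of_bool (C1 \<mu> \<nu> > C2 \<mu> \<nu>) > 0}"

end

(* With e n = (w n)^2 / p n, the linearized generator is a reversible nearest-neighbour walk plus a
mean-field term. Young's inequality on the edges bounds the Dirichlet form from below by
(1 - sqrt q)^2 on the right half-line and q (1 - sqrt \<sigma>)^2 on the left one, with an error at 0. The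
vanishing half-line first moments give R^2 <= \<rho> Ep and D^2 <= \<delta> Em for the half-line masses R, D and
entropies Ep, Em, and w 0 = - R - D. This controls both the error at 0 (through gamma) and the
mean-field term (through C3), so that dE/dt <= - 2 \<theta> E with \<theta> the quantity defining G_set.

A solution is only assumed to lie in l^1 at each time, without local uniformity. Since the generator
is bounded, norms grow at most by a factor 2 on short intervals on which they are bounded; a Baire
argument removes the boundedness assumption, and truncated weights propagate finiteness of E. *)
theory Submission
  imports Defs
begin

subsection \<open>Componentwise differentiable curves\<close>

text \<open>Everything is computed in the neighbour ratios \<open>q\<close> and
  \<open>\<sigma>\<close> of the stationary weights, of which \<open>p0\<close>, \<open>r\<close>,
  \<open>d\<close> are rational functions. Two points decide whether the constants of
  \<open>G_set\<close> suffice. The mean-field form in the half-line masses has a mixed term, while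
  \<open>C3\<close> is only the trace of its rescaled matrix. The trace dominates once the
  determinant is nonnegative; this follows from \<open>\<sigma> \<le> 1 - q\<close>, itself a
  consequence of \<open>C4 > C3\<close>. The site 0 is shared by two edges of different strength and
  may lack the decay rate of the half-lines; its deficit is at most \<open>C1 - C2\<close>, because
  the max in \<open>C2\<close> and the min in \<open>C4\<close> add up to the sum of both half-line
  rates.

  In time, neither continuity in l1 nor differentiability of the entropy is given. Increments are
  tested against frozen coefficients, so that one mean value point serves all components and the
  bounds are uniform over finite index sets. Windows whose length depends only on the operator
  bounds then let an unknown supremum be absorbed. The derivative of the entropy is obtained from
  weak convergence of difference quotients alone.\<close>

lemma sum_abs_increment_le:
  fixes u v :: "real \<Rightarrow> 'a \<Rightarrow> real"
  assumes st: "s \<le> t"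
    and der: "\<And>n \<tau>. n \<in> F \<Longrightarrow> \<tau> \<in> {s..t} \<Longrightarrow>
      ((\<lambda>\<tau>. u \<tau> n) has_real_derivative v \<tau> n) (at \<tau> within {s..t})"
    and bound: "\<And>\<tau>. \<tau> \<in> {s..t} \<Longrightarrow> (\<Sum>n\<in>F. \<bar>v \<tau> n\<bar>) \<le> K"
  shows "(\<Sum>n\<in>F. \<bar>u t n - u s n\<bar>) \<le> (t - s) * K"
proof -
  \<comment> \<open>Freezing the signs of the total increments makes the left side the increment of
    one scalar function, so a single mean value point serves all of \<open>F\<close>.\<close>
  define c where "c n = sgn (u t n - u s n)" for n
  have der': "((\<lambda>\<tau>. \<Sum>n\<in>F. c n * u \<tau> n) has_real_derivative (\<Sum>n\<in>F. c n * v x n)) (at x within {s..t})"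
    if "s \<le> x" "x \<le> t" for x
    using that by (auto intro!: DERIV_sum DERIV_cmult der)
  obtain x where x: "x \<in> {s..t}"
    and eq: "(\<Sum>n\<in>F. c n * u t n) - (\<Sum>n\<in>F. c n * u s n) = (\<Sum>n\<in>F. c n * v x n) * (t - s)"
    using mvt_very_simple[OF st, of "\<lambda>\<tau>. \<Sum>n\<in>F. c n * u \<tau> n" "\<lambda>x h. (\<Sum>n\<in>F. c n * v x n) * h"]
      der' unfolding has_field_derivative_def by blast
  have "(\<Sum>n\<in>F. \<bar>u t n - u s n\<bar>) = (\<Sum>n\<in>F. c n * u t n) - (\<Sum>n\<in>F. c n * u s n)"
    unfolding sum_subtractf[symmetric] right_diff_distrib[symmetric] c_def by (simp add: abs_sgn mult.commute)
  also have "\<dots> \<le> (t - s) * K"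
  proof -
    have "(\<Sum>n\<in>F. c n * v x n) \<le> (\<Sum>n\<in>F. \<bar>v x n\<bar>)"
      by (intro sum_mono) (auto simp: c_def sgn_if)
    then have "(\<Sum>n\<in>F. c n * v x n) \<le> K" using bound[OF x] by linarith
    then show ?thesis unfolding eq using st by (subst mult.commute) (simp add: mult_left_mono)
  qed
  finally show ?thesis .
qed

lemma sum_square_increment_le:
  fixes u v :: "real \<Rightarrow> 'a \<Rightarrow> real"
  assumes st: "s \<le> t"
    and a: "\<And>n. n \<in> F \<Longrightarrow> 0 \<le> a n"
    and der: "\<And>n \<tau>. n \<in> F \<Longrightarrow> \<tau> \<in> {s..t} \<Longrightarrow>
      ((\<lambda>\<tau>. u \<tau> n) has_real_derivative v \<tau> n) (at \<tau> within {s..t})"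
    and bound: "\<And>\<tau>. \<tau> \<in> {s..t} \<Longrightarrow> (\<Sum>n\<in>F. a n * (v \<tau> n)\<^sup>2) \<le> K"
  shows "(\<Sum>n\<in>F. a n * (u t n - u s n)\<^sup>2) \<le> (t - s)\<^sup>2 * K"
proof -
  \<comment> \<open>Same device, with the increment itself as frozen multiplier; Young's inequality
    then returns half of the left side, which is absorbed.\<close>
  define z where "z n = u t n - u s n" for n
  have der': "((\<lambda>\<tau>. \<Sum>n\<in>F. a n * z n * u \<tau> n) has_real_derivative (\<Sum>n\<in>F. a n * z n * v x n)) (at x within {s..t})"
    if "s \<le> x" "x \<le> t" for x
    using that by (auto intro!: DERIV_sum DERIV_cmult der)
  obtain x where x: "x \<in> {s..t}"
    and eq: "(\<Sum>n\<in>F. a n * z n * u t n) - (\<Sum>n\<in>F. a n * z n * u s n) = (\<Sum>n\<in>F. a n * z n * v x n) * (t - s)"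
    using mvt_very_simple[OF st, of "\<lambda>\<tau>. \<Sum>n\<in>F. a n * z n * u \<tau> n" "\<lambda>x h. (\<Sum>n\<in>F. a n * z n * v x n) * h"]
      der' unfolding has_field_derivative_def by blast
  have "(\<Sum>n\<in>F. a n * (z n)\<^sup>2) = (\<Sum>n\<in>F. a n * z n * v x n) * (t - s)"
    unfolding eq[symmetric] sum_subtractf[symmetric]
    by (intro sum.cong) (auto simp: z_def power2_eq_square algebra_simps)
  also have "\<dots> \<le> (\<Sum>n\<in>F. a n * (z n)\<^sup>2) / 2 + (t - s)\<^sup>2 * (\<Sum>n\<in>F. a n * (v x n)\<^sup>2) / 2"
    unfolding sum_distrib_right sum_distrib_left sum_divide_distrib sum.distrib[symmetric]
  proof (rule sum_mono)
    fix n assume "n \<in> F"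
    have "z n * v x n * (t - s) \<le> ((z n)\<^sup>2 + (v x n * (t - s))\<^sup>2) / 2"
      using sum_squares_bound[of "z n" "v x n * (t - s)"] by (simp add: algebra_simps)
    then have "a n * (z n * v x n * (t - s)) \<le> a n * (((z n)\<^sup>2 + (v x n * (t - s))\<^sup>2) / 2)"
      using a[OF \<open>n \<in> F\<close>] by (rule mult_left_mono)
    then show "a n * z n * v x n * (t - s) \<le> a n * (z n)\<^sup>2 / 2 + (t - s)\<^sup>2 * (a n * (v x n)\<^sup>2) / 2"
      by (simp only: power_mult_distrib) (simp add: distrib_left add_divide_distrib mult_ac)
  qed
  finally have "(\<Sum>n\<in>F. a n * (z n)\<^sup>2) \<le> (t - s)\<^sup>2 * (\<Sum>n\<in>F. a n * (v x n)\<^sup>2)" by simp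
  also have "\<dots> \<le> (t - s)\<^sup>2 * K" using bound[OF x] by (simp add: mult_left_mono)
  finally show ?thesis by (simp add: z_def)
qed

section \<open>Boundedness on compact time intervals from a conditional growth bound\<close>

lemma compact_bdd_above_of_local:
  fixes N :: "real \<Rightarrow> real"
  assumes "compact C" and loc: "\<And>t. t \<in> C \<Longrightarrow> \<exists>e>0. bdd_above (N ` (ball t e \<inter> C))"
  shows "bdd_above (N ` C)"
proof -
  obtain e where e: "\<And>t. t \<in> C \<Longrightarrow> e t > 0 \<and> bdd_above (N ` (ball t (e t) \<inter> C))"
    using loc by metis
  obtain D where D: "D \<subseteq> C" "finite D" "C \<subseteq> (\<Union>t\<in>D. ball t (e t))"
  proof (rule compactE_image[OF \<open>compact C\<close>, of C "\<lambda>t. ball t (e t)"])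
    show "C \<subseteq> (\<Union>t\<in>C. ball t (e t))" using e by (meson UN_I centre_in_ball subsetI)
  qed auto
  have "bdd_above (\<Union>t\<in>D. N ` (ball t (e t) \<inter> C))"
    using D e by (subst bdd_above_UN) auto
  moreover have "N ` C \<subseteq> (\<Union>t\<in>D. N ` (ball t (e t) \<inter> C))" using D by blast
  ultimately show ?thesis by (rule bdd_above_mono)
qed

text \<open>The set of times near which \<open>N\<close> is unbounded is closed. If it were nonempty, then by Baire
  \<open>N\<close> would be bounded on a relatively open piece of it, and the growth bound, started from the
  nearest bad time, would carry this bound over to a full neighbourhood.\<close>

lemma bdd_above_of_growth:
  fixes N :: "real \<Rightarrow> real"
  assumes h: "h > 0"
    and cl: "\<And>m::nat. closed {t. 0 \<le> t \<and> N t \<le> real m}"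
    and growth: "\<And>s t. 0 \<le> s \<Longrightarrow> 0 \<le> t \<Longrightarrow> \<bar>t - s\<bar> \<le> h \<Longrightarrow>
      bdd_above (N ` closed_segment s t) \<Longrightarrow> N t \<le> 2 * N s"
  shows "bdd_above (N ` {0..T})"
proof -
  \<comment> \<open>The good times, near which \<open>N\<close> is bounded relative to the
    half-line; the bad times \<open>K\<close> below are their complement in it.\<close>
  define G where "G = {t. \<exists>e>0. bdd_above (N ` (ball t e \<inter> {0..}))}"
  have G_iff: "t \<in> G \<longleftrightarrow> (\<exists>e>0. bdd_above (N ` (ball t e \<inter> {0..})))" for t
    by (simp add: G_def)
  have "open G"
    unfolding open_contains_ball
  proof
    fix t assume "t \<in> G"
    then obtain e where e: "e > 0" "bdd_above (N ` (ball t e \<inter> {0..}))" by (auto simp: G_iff)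
    have "t' \<in> G" if "t' \<in> ball t (e/2)" for t'
    proof -
      have "ball t' (e/2) \<subseteq> ball t e"
      proof
        fix y assume "y \<in> ball t' (e/2)"
        then show "y \<in> ball t e" using that unfolding mem_ball dist_real_def by linarith
      qed
      then have "bdd_above (N ` (ball t' (e/2) \<inter> {0..}))"
        by (intro bdd_above_mono[OF e(2)]) auto
      then show ?thesis using e(1) by (auto simp: G_iff intro!: exI[of _ "e/2"])
    qed
    then show "\<exists>e>0. ball t e \<subseteq> G" using e(1) by (intro exI[of _ "e/2"]) auto
  qed
  define K where "K = {0..} - G"
  have clK: "closed K" unfolding K_def using \<open>open G\<close> by (simp add: closed_Diff)
  have bdd_seg: "bdd_above (N ` C)" if "compact C" "C \<subseteq> {0..}" "C \<inter> K = {}" for C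
  proof (rule compact_bdd_above_of_local[OF \<open>compact C\<close>])
    fix t assume "t \<in> C"
    then have "t \<in> G" using that by (auto simp: K_def)
    then obtain e where e: "e > 0" "bdd_above (N ` (ball t e \<inter> {0..}))" by (auto simp: G_iff)
    have "bdd_above (N ` (ball t e \<inter> C))"
      using that(2) by (intro bdd_above_mono[OF e(2)] image_mono) blast
    then show "\<exists>e>0. bdd_above (N ` (ball t e \<inter> C))" using e(1) by blast
  qed
  have "K = {}"
  proof (rule ccontr)
    assume "K \<noteq> {}"
    define Km where "Km m = {t. 0 \<le> t \<and> N t \<le> real m} \<inter> K" for m :: nat
    \<comment> \<open>Otherwise each \<open>K - Km m\<close> is relatively open and dense in
      \<open>K\<close>, and Baire makes their intersection dense; it is empty, since every value of
      \<open>N\<close> lies below some natural number.\<close>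
    have "\<exists>m. \<not> K \<subseteq> closure (K - Km m)"
    proof (rule ccontr)
      assume "\<not> ?thesis"
      then have dense: "K \<subseteq> closure (K - Km m)" for m by blast
      have "K \<subseteq> closure (\<Inter>(range (\<lambda>m. K - Km m)))"
      proof (rule Baire[OF clK])
        show "openin (top_of_set K) T \<and> K \<subseteq> closure T" if T_in: "T \<in> range (\<lambda>m. K - Km m)" for T
        proof -
          obtain m where T: "T = K - Km m" using T_in by blast
          have "K - Km m = K \<inter> (- {t. 0 \<le> t \<and> N t \<le> real m})" by (auto simp: Km_def)
          then have "openin (top_of_set K) T"
            unfolding T using openin_open_Int[OF open_Compl[OF cl[of m]]] by simp
          then show ?thesis using dense T by auto
        qed
      qed auto
      moreover have "\<Inter>(range (\<lambda>m. K - Km m)) = {}"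
      proof -
        have "\<exists>m. t \<in> Km m" if "t \<in> K" for t
          using that real_arch_simple[of "N t"] by (auto simp: Km_def K_def)
        then show ?thesis by auto
      qed
      ultimately show False using \<open>K \<noteq> {}\<close> by (metis closure_empty subset_empty)
    qed
    then obtain m t0 where t0: "t0 \<in> K" "t0 \<notin> closure (K - Km m)" by blast
    then obtain e0 where e0: "e0 > 0" "\<And>y. y \<in> K - Km m \<Longrightarrow> \<not> dist y t0 < e0"
      unfolding closure_approachable by blast
    define e where "e = min e0 h"
    have e: "e > 0" "e \<le> h" "\<And>k. k \<in> K \<Longrightarrow> \<bar>k - t0\<bar> < e \<Longrightarrow> N k \<le> real m"
    proof -
      show "e > 0" "e \<le> h" using e0(1) h by (simp_all add: e_def)
      fix k assume "k \<in> K" "\<bar>k - t0\<bar> < e"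
      then have "k \<in> Km m" using e0(2)[of k] by (auto simp: e_def dist_real_def)
      then show "N k \<le> real m" by (simp add: Km_def)
    qed
    have bound: "N t \<le> 2 * real m" if "0 \<le> t" "\<bar>t - t0\<bar> < e" for t
    proof -
      let ?S = "K \<inter> closed_segment t0 t"
      \<comment> \<open>\<open>k\<close> is the bad time nearest to \<open>t\<close> among those
        between \<open>t0\<close> and \<open>t\<close>; the bound by \<open>m\<close> is available
        there because \<open>k\<close> lies in \<open>K\<close> close to \<open>t0\<close>.\<close>
      have "closed ?S" "?S \<noteq> {}" using clK t0 by (auto intro: closed_Int)
      then obtain k where k: "k \<in> ?S" and kmin: "\<And>y. y \<in> ?S \<Longrightarrow> dist t k \<le> dist t y"
        using distance_attains_inf[of ?S t] by blast
      have seg_iff: "x \<in> closed_segment y z \<longleftrightarrow> y \<le> x \<and> x \<le> z \<or> z \<le> x \<and> x \<le> y" for x y z :: real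
        by (auto simp: closed_segment_eq_real_ivl)
      have seg_nonneg: "closed_segment y z \<subseteq> {0..}" if "0 \<le> y" "0 \<le> z" for y z :: real
        using that unfolding subset_iff seg_iff by auto
      have kK: "k \<in> K" and kt: "t0 \<le> k \<and> k \<le> t \<or> t \<le> k \<and> k \<le> t0"
        using k seg_iff[of k t0 t] by blast+
      have k0: "0 \<le> k" using kK by (auto simp: K_def)
      have "\<bar>k - t0\<bar> < e" using kt \<open>\<bar>t - t0\<bar> < e\<close> by arith
      then have km: "N k \<le> real m" by (rule e(3)[OF kK])
      \<comment> \<open>Growth is first used from \<open>t\<close> towards \<open>k\<close>: the
        segment from \<open>t\<close> to any \<open>s\<close> short of \<open>k\<close> has no bad
        time, so \<open>N\<close> is bounded on it. This bounds \<open>N\<close> on the whole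
        segment, bad endpoint included, and only then may growth be applied from \<open>k\<close> to
        \<open>t\<close>.\<close>
      have seg: "N s \<le> 2 * N t" if "s \<in> closed_segment k t" "s \<noteq> k" for s
      proof -
        have s: "k \<le> s \<and> s \<le> t \<or> t \<le> s \<and> s \<le> k" using that(1) unfolding seg_iff .
        have s0: "0 \<le> s" using s k0 \<open>0 \<le> t\<close> by arith
        have "y \<notin> K" if "y \<in> closed_segment t s" for y
        proof
          assume "y \<in> K"
          have y: "t \<le> y \<and> y \<le> s \<or> s \<le> y \<and> y \<le> t" using that unfolding seg_iff .
          have "t0 \<le> y \<and> y \<le> t \<or> t \<le> y \<and> y \<le> t0" using kt s y by arith
          then have "y \<in> ?S" using \<open>y \<in> K\<close> by (simp add: seg_iff)
          from kmin[OF this] have "\<bar>t - k\<bar> \<le> \<bar>t - y\<bar>" by (simp add: dist_real_def)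
          then show False using y s \<open>s \<noteq> k\<close> by arith
        qed
        then have "bdd_above (N ` closed_segment t s)"
          using seg_nonneg[OF \<open>0 \<le> t\<close> s0] by (intro bdd_seg) auto
        moreover have "\<bar>s - t\<bar> \<le> h"
          using s kt \<open>\<bar>t - t0\<bar> < e\<close> e(2) by arith
        ultimately show ?thesis using growth[OF \<open>0 \<le> t\<close> s0] by blast
      qed
      have "N s \<le> max (N k) (2 * N t)" if "s \<in> closed_segment k t" for s
        using seg[OF that] by (cases "s = k") auto
      then have "bdd_above (N ` closed_segment k t)" by (rule bdd_aboveI2)
      moreover have "\<bar>t - k\<bar> \<le> h"
        using kt \<open>\<bar>t - t0\<bar> < e\<close> e(2) by arith
      ultimately have "N t \<le> 2 * N k" using growth[OF k0 \<open>0 \<le> t\<close>] by blast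
      then show ?thesis using km by linarith
    qed
    have "bdd_above (N ` (ball t0 e \<inter> {0..}))"
    proof (rule bdd_aboveI2)
      show "N t \<le> 2 * real m" if "t \<in> ball t0 e \<inter> {0..}" for t
        using that by (intro bound) (simp_all add: dist_real_def abs_minus_commute)
    qed
    then have "t0 \<in> G" using e(1) by (auto simp: G_iff)
    then show False using t0 by (auto simp: K_def)
  qed
  then show ?thesis by (intro bdd_seg) auto
qed

section \<open>Weighted square sums and their time derivative\<close>

lemma nonneg_summable_infsum_le:
  fixes f :: "'a \<Rightarrow> real"
  assumes "\<And>n. 0 \<le> f n" and "\<And>F. finite F \<Longrightarrow> sum f F \<le> B"
  shows "f summable_on UNIV" "infsum f UNIV \<le> B"
proof -
  show "f summable_on UNIV"
    using assms by (intro nonneg_bdd_above_summable_on bdd_aboveI2[of _ _ B]) auto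
  then show "infsum f UNIV \<le> B" using assms by (intro infsum_le_finite_sums) auto
qed

lemma summable_on_abs:
  fixes f :: "'a \<Rightarrow> real"
  shows "f summable_on A \<Longrightarrow> (\<lambda>n. \<bar>f n\<bar>) summable_on A"
  by (subst (asm) summable_on_iff_abs_summable_on_real) simp

lemma abs_mult_le_weighted_squares:
  fixes a :: real
  assumes "0 \<le> a" "0 < c"
  shows "\<bar>a * f * g\<bar> \<le> a * f\<^sup>2 / (2 * c) + c * (a * g\<^sup>2) / 2"
proof -
  have "0 \<le> (\<bar>f\<bar> - c * \<bar>g\<bar>)\<^sup>2" by simp
  then have "2 * c * (\<bar>f\<bar> * \<bar>g\<bar>) \<le> f\<^sup>2 + c\<^sup>2 * g\<^sup>2"
    by (simp add: power2_diff power_mult_distrib mult_ac)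
  then have "\<bar>f\<bar> * \<bar>g\<bar> \<le> (f\<^sup>2 + c\<^sup>2 * g\<^sup>2) / (2 * c)"
    using \<open>0 < c\<close> by (subst pos_le_divide_eq) (auto simp: mult_ac)
  also have "\<dots> = f\<^sup>2 / (2 * c) + c * g\<^sup>2 / 2"
    using \<open>0 < c\<close> by (simp add: add_divide_distrib power2_eq_square)
  finally have "a * (\<bar>f\<bar> * \<bar>g\<bar>) \<le> a * (f\<^sup>2 / (2 * c) + c * g\<^sup>2 / 2)"
    using \<open>0 \<le> a\<close> by (rule mult_left_mono)
  then show ?thesis
    using \<open>0 \<le> a\<close> by (simp add: abs_mult distrib_left mult_ac)
qed

lemma summable_on_weighted_product:
  fixes f g :: "'a \<Rightarrow> real"
  assumes a: "\<And>n. 0 \<le> a n"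
    and f: "(\<lambda>n. a n * (f n)\<^sup>2) summable_on A" and g: "(\<lambda>n. a n * (g n)\<^sup>2) summable_on A"
  shows "(\<lambda>n. a n * f n * g n) summable_on A"
proof (subst summable_on_iff_abs_summable_on_real, rule summable_on_comparison_test)
  show "(\<lambda>n. 1 / 2 * (a n * (f n)\<^sup>2) + 1 / 2 * (a n * (g n)\<^sup>2)) summable_on A"
    by (intro summable_on_add summable_on_cmult_right f g)
  show "norm (a n * f n * g n) \<le> 1 / 2 * (a n * (f n)\<^sup>2) + 1 / 2 * (a n * (g n)\<^sup>2)" for n
    using abs_mult_le_weighted_squares[OF a[of n] zero_less_one, of "f n" "g n"] by simp
qed auto

text \<open>Bounded and componentwise null sequences are weakly null: a finite block is handled by
  the componentwise limits, the tail by Young's inequality with the smallness of the tail of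
  \<open>f\<close>.\<close>

lemma weighted_weak_convergence:
  fixes f :: "'a \<Rightarrow> real" and x :: "'b \<Rightarrow> 'a \<Rightarrow> real"
  assumes a: "\<And>n. 0 \<le> a n"
    and f: "(\<lambda>n. a n * (f n)\<^sup>2) summable_on UNIV"
    and x: "\<forall>\<^sub>F j in L. (\<lambda>n. a n * (x j n)\<^sup>2) summable_on UNIV \<and> (\<Sum>\<^sub>\<infinity>n. a n * (x j n)\<^sup>2) \<le> B"
    and lim: "\<And>n. ((\<lambda>j. x j n) \<longlongrightarrow> 0) L"
  shows "((\<lambda>j. \<Sum>\<^sub>\<infinity>n. a n * f n * x j n) \<longlongrightarrow> 0) L"
proof (rule tendstoI)
  fix \<epsilon> :: real assume "\<epsilon> > 0"
  \<comment> \<open>The Young parameter is tuned so that the tail of \<open>x\<close> costs at most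
    \<open>\<epsilon> / 2\<close> and the tail of \<open>f\<close> at most
    \<open>\<epsilon> / 4\<close>, leaving \<open>\<epsilon> / 4\<close> for the finite block; the
    added 1 keeps the denominator positive.\<close>
  define c where "c = \<epsilon> / (\<bar>B\<bar> + 1)"
  have c: "c > 0" "c * \<bar>B\<bar> \<le> \<epsilon>" using \<open>\<epsilon> > 0\<close> by (auto simp: c_def field_simps)
  let ?e = "\<lambda>n. a n * (f n)\<^sup>2"
  obtain F where F: "finite F" "dist (sum ?e F) (infsum ?e UNIV) \<le> c * \<epsilon> / 2"
    using infsum_finite_approximation[OF f, of "c * \<epsilon> / 2"] c(1) \<open>\<epsilon> > 0\<close> by auto
  have eF: "?e summable_on - F" by (rule summable_on_subset_banach[OF f]) auto
  have "infsum ?e UNIV = sum ?e F + infsum ?e (- F)"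
    using infsum_Un_disjoint[OF summable_on_finite[OF F(1)] eF] F(1) by (simp add: Compl_partition)
  then have tail: "infsum ?e (- F) \<le> c * \<epsilon> / 2" using F(2) by (simp add: dist_real_def)
  have "((\<lambda>j. \<Sum>n\<in>F. a n * f n * x j n) \<longlongrightarrow> (\<Sum>n\<in>F. a n * f n * 0)) L"
    by (intro tendsto_intros lim)
  then have "((\<lambda>j. \<Sum>n\<in>F. a n * f n * x j n) \<longlongrightarrow> 0) L" by simp
  from tendstoD[OF this, of "\<epsilon> / 4"] have "\<forall>\<^sub>F j in L. \<bar>\<Sum>n\<in>F. a n * f n * x j n\<bar> < \<epsilon> / 4"
    using \<open>\<epsilon> > 0\<close> by simp
  with x show "\<forall>\<^sub>F j in L. dist (\<Sum>\<^sub>\<infinity>n. a n * f n * x j n) 0 < \<epsilon>"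
  proof eventually_elim
    case (elim j)
    let ?x = "\<lambda>n. a n * (x j n)\<^sup>2" and ?g = "\<lambda>n. a n * f n * x j n"
    have gs: "?g summable_on UNIV" using a f elim by (intro summable_on_weighted_product) auto
    have gF: "?g summable_on - F" by (rule summable_on_subset_banach[OF gs]) auto
    have xF: "?x summable_on - F" by (rule summable_on_subset_banach[of _ UNIV]) (use elim in auto)
    have xB: "infsum ?x (- F) \<le> \<bar>B\<bar>"
    proof -
      have "infsum ?x (- F) \<le> infsum ?x UNIV"
        using elim xF a by (intro infsum_mono_neutral) auto
      then show ?thesis using elim by linarith
    qed
    have split: "infsum ?g UNIV = sum ?g F + infsum ?g (- F)"
      using infsum_Un_disjoint[OF summable_on_finite[OF F(1)] gF] F(1) by (simp add: Compl_partition)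
    have "\<bar>infsum ?g (- F)\<bar> \<le> infsum (\<lambda>n. \<bar>?g n\<bar>) (- F)"
      using norm_infsum_bound[of ?g "- F"] summable_on_abs[OF gF] by simp
    also have "\<dots> \<le> infsum (\<lambda>n. 1 / (2 * c) * ?e n + c / 2 * ?x n) (- F)"
    proof (rule infsum_mono)
      show "(\<lambda>n. \<bar>?g n\<bar>) summable_on - F" by (rule summable_on_abs[OF gF])
      show "(\<lambda>n. 1 / (2 * c) * ?e n + c / 2 * ?x n) summable_on - F"
        by (intro summable_on_add summable_on_cmult_right eF xF)
      show "\<bar>?g n\<bar> \<le> 1 / (2 * c) * ?e n + c / 2 * ?x n" for n
        using abs_mult_le_weighted_squares[OF a[of n] c(1), of "f n" "x j n"] by simp
    qed
    also have "\<dots> = 1 / (2 * c) * infsum ?e (- F) + c / 2 * infsum ?x (- F)"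
      using eF xF by (simp only: infsum_add summable_on_cmult_right infsum_cmult_right')
    also have "\<dots> \<le> 1 / (2 * c) * (c * \<epsilon> / 2) + c / 2 * \<bar>B\<bar>"
      using tail xB c(1) by (intro add_mono mult_left_mono) auto
    also have "\<dots> \<le> \<epsilon> / 4 + \<epsilon> / 2" using c by simp
    finally have "\<bar>infsum ?g UNIV\<bar> < \<epsilon>" unfolding split using elim \<open>\<epsilon> > 0\<close> by linarith
    then show ?case by (simp add: dist_real_def)
  qed
qed

text \<open>Difference quotients are bounded in the weighted \<open>\<ell>\<^sup>2\<close> norm and converge in
  every component, hence weakly; this suffices to differentiate the squared norm.\<close>

lemma has_derivative_weighted_square_sum:
  fixes u v :: "real \<Rightarrow> 'a \<Rightarrow> real"
  assumes a: "\<And>n. 0 \<le> a n"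
    and der: "\<And>n \<tau>. \<tau> \<in> {s..t} \<Longrightarrow> ((\<lambda>\<tau>. u \<tau> n) has_real_derivative v \<tau> n) (at \<tau> within {s..t})"
    and u: "\<And>\<tau>. \<tau> \<in> {s..t} \<Longrightarrow> (\<lambda>n. a n * (u \<tau> n)\<^sup>2) summable_on UNIV"
    and v: "\<And>\<tau>. \<tau> \<in> {s..t} \<Longrightarrow> (\<lambda>n. a n * (v \<tau> n)\<^sup>2) summable_on UNIV"
    and vK: "\<And>\<tau>. \<tau> \<in> {s..t} \<Longrightarrow> (\<Sum>\<^sub>\<infinity>n. a n * (v \<tau> n)\<^sup>2) \<le> K"
    and x: "x \<in> {s..t}"
  shows "((\<lambda>\<tau>. \<Sum>\<^sub>\<infinity>n. a n * (u \<tau> n)\<^sup>2) has_real_derivative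
    2 * (\<Sum>\<^sub>\<infinity>n. a n * u x n * v x n)) (at x within {s..t})"
proof -
  let ?S = "{s..t}" and ?E = "\<lambda>\<tau>. \<Sum>\<^sub>\<infinity>n. a n * (u \<tau> n)\<^sup>2"
  define q where "q y n = (u y n - u x n) / (y - x)" for y n
  have vF: "(\<Sum>n\<in>F. a n * (v \<tau> n)\<^sup>2) \<le> K" if "finite F" "\<tau> \<in> ?S" for F \<tau>
    using finite_sum_le_infsum[OF v[OF that(2)] that(1)] a vK[OF that(2)] by fastforce
  have inc: "(\<Sum>n\<in>F. a n * (u y n - u x n)\<^sup>2) \<le> (y - x)\<^sup>2 * K" if "y \<in> ?S" "finite F" for y F
  proof (cases "x \<le> y")
    case True
    show ?thesis
      by (rule sum_square_increment_le[OF True a, of F u v])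
        (use that x True in \<open>auto intro!: vF intro: has_field_derivative_subset[OF der]\<close>)
  next
    case False
    have "(\<Sum>n\<in>F. a n * (u x n - u y n)\<^sup>2) \<le> (x - y)\<^sup>2 * K"
      by (rule sum_square_increment_le[of y x F a u v])
        (use that x False a in \<open>auto intro!: vF intro: has_field_derivative_subset[OF der]\<close>)
    then show ?thesis by (simp add: power2_commute)
  qed
  have qK: "(\<lambda>n. a n * (q y n)\<^sup>2) summable_on UNIV" "(\<Sum>\<^sub>\<infinity>n. a n * (q y n)\<^sup>2) \<le> K"
    if y: "y \<in> ?S" "y \<noteq> x" for y
  proof -
    have "(\<Sum>n\<in>F. a n * (q y n)\<^sup>2) \<le> K" if "finite F" for F
    proof -
      have "(\<Sum>n\<in>F. a n * (q y n)\<^sup>2) = (\<Sum>n\<in>F. a n * (u y n - u x n)\<^sup>2) / (y - x)\<^sup>2"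
        by (simp add: q_def power_divide sum_divide_distrib)
      also have "\<dots> \<le> K" using inc[OF y(1) that] y(2) by (simp add: divide_le_eq mult.commute)
      finally show ?thesis .
    qed
    then show "(\<lambda>n. a n * (q y n)\<^sup>2) summable_on UNIV" "(\<Sum>\<^sub>\<infinity>n. a n * (q y n)\<^sup>2) \<le> K"
      using a by (auto intro!: nonneg_summable_infsum_le)
  qed
  have K: "0 \<le> K" using infsum_nonneg[of UNIV "\<lambda>n. a n * (v x n)\<^sup>2"] a vK[OF x] by fastforce
  have diff: "(\<lambda>n. a n * (q y n - v x n)\<^sup>2) summable_on UNIV \<and> (\<Sum>\<^sub>\<infinity>n. a n * (q y n - v x n)\<^sup>2) \<le> 4 * K"
    if y: "y \<in> ?S" "y \<noteq> x" for y
  proof -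
    have "(\<Sum>n\<in>F. a n * (q y n - v x n)\<^sup>2) \<le> 4 * K" if "finite F" for F
    proof -
      have "(\<Sum>n\<in>F. a n * (q y n - v x n)\<^sup>2) \<le> (\<Sum>n\<in>F. 2 * (a n * (q y n)\<^sup>2) + 2 * (a n * (v x n)\<^sup>2))"
      proof (rule sum_mono)
        fix n
        have "(q y n - v x n)\<^sup>2 \<le> 2 * (q y n)\<^sup>2 + 2 * (v x n)\<^sup>2"
          using zero_le_power2[of "q y n + v x n"] by (simp add: power2_eq_square algebra_simps)
        from mult_left_mono[OF this a[of n]]
        show "a n * (q y n - v x n)\<^sup>2 \<le> 2 * (a n * (q y n)\<^sup>2) + 2 * (a n * (v x n)\<^sup>2)"
          by (simp add: algebra_simps)
      qed
      also have "\<dots> = 2 * (\<Sum>n\<in>F. a n * (q y n)\<^sup>2) + 2 * (\<Sum>n\<in>F. a n * (v x n)\<^sup>2)"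
        by (simp add: sum.distrib sum_distrib_left)
      also have "\<dots> \<le> 2 * K + 2 * K"
        using finite_sum_le_infsum[OF qK(1)[OF y] that] qK(2)[OF y] vF[OF that x] a
        by (intro add_mono mult_left_mono) fastforce+
      finally show ?thesis by simp
    qed
    then show ?thesis using a by (auto intro!: nonneg_summable_infsum_le)
  qed
  have ev: "\<forall>\<^sub>F y in at x within ?S. y \<in> ?S \<and> y \<noteq> x"
    by (auto simp: eventually_at_filter)
  have weak: "((\<lambda>y. \<Sum>\<^sub>\<infinity>n. a n * u x n * (q y n - v x n)) \<longlongrightarrow> 0) (at x within ?S)"
  proof (rule weighted_weak_convergence[OF a u[OF x]])
    show "\<forall>\<^sub>F y in at x within ?S. (\<lambda>n. a n * (q y n - v x n)\<^sup>2) summable_on UNIV \<and>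
        (\<Sum>\<^sub>\<infinity>n. a n * (q y n - v x n)\<^sup>2) \<le> 4 * K"
      using ev by eventually_elim (use diff in auto)
    show "((\<lambda>y. q y n - v x n) \<longlongrightarrow> 0) (at x within ?S)" for n
      using der[OF x, of n] unfolding has_field_derivative_iff q_def by (simp add: LIM_zero_iff)
  qed
  have "((\<lambda>y. (y - x) * (\<Sum>\<^sub>\<infinity>n. a n * (q y n)\<^sup>2)) \<longlongrightarrow> 0) (at x within ?S)"
  proof (rule Lim_null_comparison)
    show "\<forall>\<^sub>F y in at x within ?S. norm ((y - x) * (\<Sum>\<^sub>\<infinity>n. a n * (q y n)\<^sup>2)) \<le> \<bar>y - x\<bar> * K"
      using ev
    proof eventually_elim
      case (elim y)
      have "0 \<le> (\<Sum>\<^sub>\<infinity>n. a n * (q y n)\<^sup>2)" using a by (intro infsum_nonneg) auto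
      then show ?case using qK(2)[of y] elim by (simp add: abs_mult mult_left_mono)
    qed
    have "((\<lambda>y. \<bar>y - x\<bar> * K) \<longlongrightarrow> \<bar>x - x\<bar> * K) (at x within ?S)" by (intro tendsto_intros)
    then show "((\<lambda>y. \<bar>y - x\<bar> * K) \<longlongrightarrow> 0) (at x within ?S)" by simp
  qed
  from tendsto_add[OF tendsto_add[OF tendsto_const tendsto_mult[OF tendsto_const weak]] this]
  have "((\<lambda>y. 2 * (\<Sum>\<^sub>\<infinity>n. a n * u x n * v x n) + 2 * (\<Sum>\<^sub>\<infinity>n. a n * u x n * (q y n - v x n))
      + (y - x) * (\<Sum>\<^sub>\<infinity>n. a n * (q y n)\<^sup>2)) \<longlongrightarrow> 2 * (\<Sum>\<^sub>\<infinity>n. a n * u x n * v x n)) (at x within ?S)"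
    by simp
  moreover have "\<forall>\<^sub>F y in at x within ?S.
      2 * (\<Sum>\<^sub>\<infinity>n. a n * u x n * v x n) + 2 * (\<Sum>\<^sub>\<infinity>n. a n * u x n * (q y n - v x n))
      + (y - x) * (\<Sum>\<^sub>\<infinity>n. a n * (q y n)\<^sup>2) = (?E y - ?E x) / (y - x)"
    using ev
  proof eventually_elim
    case (elim y)
    then have y: "y \<in> ?S" "y \<noteq> x" by auto
    have s1: "(\<lambda>n. a n * u x n * v x n) summable_on UNIV"
      by (rule summable_on_weighted_product[OF a u[OF x] v[OF x]])
    have s2: "(\<lambda>n. a n * u x n * (q y n - v x n)) summable_on UNIV"
      using diff[OF y] by (intro summable_on_weighted_product[OF a u[OF x]]) auto
    note h = has_sum_add[OF has_sum_add[OF has_sum_cmult_right[OF has_sum_infsum[OF s1], of 2]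
          has_sum_cmult_right[OF has_sum_infsum[OF s2], of 2]]
          has_sum_cmult_right[OF has_sum_infsum[OF qK(1)[OF y]], of "y - x"]]
    have "((\<lambda>n. (a n * (u y n)\<^sup>2 + (- 1) * (a n * (u x n)\<^sup>2)) * (1 / (y - x))) has_sum
        (?E y + (- 1) * ?E x) * (1 / (y - x))) UNIV"
      by (intro has_sum_cmult_left has_sum_add has_sum_cmult_right has_sum_infsum u x y)
    moreover have "(a n * (u y n)\<^sup>2 + (- 1) * (a n * (u x n)\<^sup>2)) * (1 / (y - x)) =
       2 * (a n * u x n * v x n) + 2 * (a n * u x n * (q y n - v x n)) + (y - x) * (a n * (q y n)\<^sup>2)" for n
    proof -
      have "(A * (X + Q * D)\<^sup>2 + (- 1) * (A * X\<^sup>2)) * (1 / D) = 2 * (A * X * W) + 2 * (A * X * (Q - W)) + D * (A * Q\<^sup>2)"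
        if "D \<noteq> 0" for A X Q D W :: real
        using that by (simp add: field_simps power2_eq_square)
      moreover have "u y n = u x n + q y n * (y - x)" using y(2) by (simp add: q_def)
      ultimately show ?thesis using y(2) by (metis eq_iff_diff_eq_0)
    qed
    ultimately have "((\<lambda>n. 2 * (a n * u x n * v x n) + 2 * (a n * u x n * (q y n - v x n)) + (y - x) * (a n * (q y n)\<^sup>2))
       has_sum (?E y + (- 1) * ?E x) * (1 / (y - x))) UNIV" by simp
    from has_sum_unique[OF h this] show ?case by simp
  qed
  ultimately show ?thesis
    unfolding has_field_derivative_iff by (rule Lim_transform_eventually)
qed

text \<open>Cauchy--Schwarz against the component of the constant function that is orthogonal to
  the identity in the geometric weight.\<close>

lemma sum_sq_le_of_first_moment_zero:
  fixes v :: "nat \<Rightarrow> real"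
  assumes z: "0 < z" "z < 1" and P: "0 < P"
    and R: "(v has_sum R) UNIV"
    and M: "((\<lambda>k. real (Suc k) * v k) has_sum 0) UNIV"
    and E: "((\<lambda>k. (v k)\<^sup>2 / (P * z ^ Suc k)) has_sum E) UNIV"
  shows "R\<^sup>2 \<le> P * z\<^sup>2 / ((1 - z) * (1 + z)) * E"
proof -
  \<comment> \<open>The projection coefficient of 1 onto the identity: with m = k + 1, the ratio of
    the sums of m z^m and m^2 z^m. The squared norm of the residual 1 - c m in the weight P z^m is
    \<open>\<rho>\<close>.\<close>
  define c where "c = (1 - z) / (1 + z)"
  define \<rho> where "\<rho> = P * z\<^sup>2 / ((1 - z) * (1 + z))"
  have \<rho>: "\<rho> > 0" using z P by (simp add: \<rho>_def)
  \<comment> \<open>Chosen by comparing coefficients so that \<open>U\<close> telescopes to the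
    weighted squares of the residual; \<open>U k\<close> is their tail sum from \<open>k\<close> on,
    and \<open>U 0\<close> the total.\<close>
  define A B C where "A = 1 / ((1 + z) * (1 - z))" and "B = 2 / (1 + z)\<^sup>2" and "C = (1 - z) / (1 + z)\<^sup>2"
  define U where "U k = P * (A * z ^ Suc k - B * (real (Suc k) * z ^ Suc k) + C * ((real (Suc k))\<^sup>2 * z ^ Suc k))" for k
  have U_diff: "U k - U (Suc k) = P * z ^ Suc k * (1 - c * real (Suc k))\<^sup>2" for k
  proof -
    define m where "m = real (Suc k)"
    have m: "real (Suc (Suc k)) = m + 1" by (simp add: m_def)
    have "(A - B * m + C * m\<^sup>2) - z * (A - B * (m + 1) + C * (m + 1)\<^sup>2) = (1 - c * m)\<^sup>2"
      using z unfolding c_def A_def B_def C_def by (simp add: divide_simps) algebra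
    then have "P * z ^ Suc k * ((A - B * m + C * m\<^sup>2) - z * (A - B * (m + 1) + C * (m + 1)\<^sup>2))
        = P * z ^ Suc k * (1 - c * m)\<^sup>2" by simp
    then show ?thesis unfolding U_def m m_def[symmetric] by (simp add: algebra_simps)
  qed
  have zn: "(\<lambda>n. real n * z ^ n) \<longlonglongrightarrow> 0" using powser_times_n_limit_0[of z] z by simp
  have zn2: "(\<lambda>n. (real n)\<^sup>2 * z ^ n) \<longlonglongrightarrow> 0"
  proof -
    have "(\<lambda>n. (real n * sqrt z ^ n) * (real n * sqrt z ^ n)) \<longlonglongrightarrow> 0 * 0"
      using powser_times_n_limit_0[of "sqrt z"] z by (intro tendsto_mult) simp_all
    moreover have "(real n * sqrt z ^ n) * (real n * sqrt z ^ n) = (real n)\<^sup>2 * z ^ n" for n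
      using z by (simp add: power2_eq_square power_mult_distrib[symmetric])
    ultimately show ?thesis by simp
  qed
  have "U \<longlonglongrightarrow> P * (A * 0 - B * 0 + C * 0)"
    unfolding U_def using z
    by (intro tendsto_intros LIMSEQ_Suc[OF zn] LIMSEQ_Suc[OF zn2] LIMSEQ_Suc LIMSEQ_power_zero) simp
  then have "U \<longlonglongrightarrow> 0" by simp
  from telescope_sums'[OF this] have "(\<lambda>k. P * z ^ Suc k * (1 - c * real (Suc k))\<^sup>2) sums U 0"
    by (simp add: U_diff)
  moreover have "U 0 = \<rho>"
    using z unfolding U_def \<rho>_def A_def B_def C_def by (simp add: divide_simps) algebra
  ultimately have W: "((\<lambda>k. P * z ^ Suc k * (1 - c * real (Suc k))\<^sup>2) has_sum \<rho>) UNIV"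
    using z P by (intro sums_nonneg_imp_has_sum) auto
  \<comment> \<open>The minimiser of \<open>E - 2 * l * R + l^2 * \<rho>\<close>, which is the
    weighted squared norm of \<open>v\<close> minus \<open>l\<close> times the weighted residual;
    the vanishing first moment removes the term with \<open>c\<close>.\<close>
  define l where "l = R / \<rho>"
  have "((\<lambda>k. (v k)\<^sup>2 / (P * z ^ Suc k) + (- 2 * l) * (v k + (- c) * (real (Suc k) * v k))
      + l\<^sup>2 * (P * z ^ Suc k * (1 - c * real (Suc k))\<^sup>2)) has_sum
      E + (- 2 * l) * (R + (- c) * 0) + l\<^sup>2 * \<rho>) UNIV"
    by (intro has_sum_add has_sum_cmult_right E R M W)
  moreover have "(v k)\<^sup>2 / (P * z ^ Suc k) + (- 2 * l) * (v k + (- c) * (real (Suc k) * v k))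
      + l\<^sup>2 * (P * z ^ Suc k * (1 - c * real (Suc k))\<^sup>2) =
      (v k - l * (P * z ^ Suc k) * (1 - c * real (Suc k)))\<^sup>2 / (P * z ^ Suc k)" for k
  proof -
    define p where "p = P * z ^ Suc k"
    have "p > 0" using P z by (simp add: p_def)
    then show ?thesis unfolding p_def[symmetric] by (simp add: field_simps power2_eq_square del: of_nat_Suc)
  qed
  ultimately have "0 \<le> E + (- 2 * l) * (R + (- c) * 0) + l\<^sup>2 * \<rho>"
    using P z by (elim has_sum_nonneg) simp
  then have "0 \<le> E - R\<^sup>2 / \<rho>" using \<rho> by (simp add: l_def field_simps power2_eq_square)
  then show ?thesis using \<rho> unfolding \<rho>_def[symmetric] by (simp add: field_simps)
qed

section \<open>Sums over the integers split at 0\<close>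

lemma has_sum_shift_int:
  fixes f :: "int \<Rightarrow> real"
  shows "((\<lambda>n. f (n + k)) has_sum S) UNIV \<longleftrightarrow> (f has_sum S) UNIV"
  by (rule has_sum_reindex_bij_witness[where i = "\<lambda>n. n - k" and j = "\<lambda>n. n + k"]) auto

lemma has_sum_int_ge_1:
  fixes f :: "int \<Rightarrow> real"
  shows "((\<lambda>k. f (int (Suc k))) has_sum S) UNIV \<longleftrightarrow> (f has_sum S) {1..}"
  by (rule has_sum_reindex_bij_witness[where i = "\<lambda>n. nat (n - 1)" and j = "\<lambda>k. int (Suc k)"]) auto

lemma has_sum_int_le_m1:
  fixes f :: "int \<Rightarrow> real"
  shows "((\<lambda>k. f (- int (Suc k))) has_sum S) UNIV \<longleftrightarrow> (f has_sum S) {..-1}"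
  by (rule has_sum_reindex_bij_witness[where i = "\<lambda>n. nat (- n - 1)" and j = "\<lambda>k. - int (Suc k)"]) auto

lemma has_sum_split_int:
  fixes f :: "int \<Rightarrow> real"
  assumes "(f has_sum R) {1..}" "(f has_sum D) {..-1}"
  shows "(f has_sum D + f 0) {..0}" "(f has_sum f 0 + R) {0..}" "(f has_sum D + f 0 + R) UNIV"
proof -
  have f0: "(f has_sum f 0) {0}" by (rule has_sum_finiteI) auto
  have "{..0} = {..-1} \<union> {0::int}" "{0..} = {0} \<union> {1::int..}" "UNIV = {..0} \<union> {1::int..}" by auto
  then show 1: "(f has_sum D + f 0) {..0}" and "(f has_sum f 0 + R) {0..}"
    using has_sum_Un_disjoint[OF assms(2) f0] has_sum_Un_disjoint[OF f0 assms(1)] by auto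
  show "(f has_sum D + f 0 + R) UNIV"
    unfolding \<open>UNIV = {..0} \<union> {1::int..}\<close> by (rule has_sum_Un_disjoint[OF 1 assms(1)]) auto
qed

lemma has_sum_piecewise:
  fixes e :: "int \<Rightarrow> real"
  assumes "(e has_sum Ep) {1..}" "(e has_sum Em) {..-1}"
  shows "((\<lambda>n. (if n \<ge> 1 then c1 else if n = 0 then c0 else c2) * e n) has_sum c2 * Em + c0 * e 0 + c1 * Ep) UNIV"
proof -
  let ?f = "\<lambda>n. (if n \<ge> 1 then c1 else if n = 0 then c0 else c2) * e n"
  have "(?f has_sum c1 * Ep) {1..}"
    using has_sum_cmult_right[OF assms(1), of c1] by (subst has_sum_cong[of _ _ "\<lambda>n. c1 * e n"]) auto
  moreover have "(?f has_sum c2 * Em) {..-1}"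
    using has_sum_cmult_right[OF assms(2), of c2] by (subst has_sum_cong[of _ _ "\<lambda>n. c2 * e n"]) auto
  ultimately show ?thesis using has_sum_split_int(3)[of ?f] by simp
qed

subsection \<open>The stationary distribution and the linearized operator\<close>

locale walk =
  fixes \<mu> \<nu> :: real
  assumes mu: "\<mu> > 0" and nu: "\<nu> > 0"
begin

abbreviation "p0 \<equiv> p0star \<mu> \<nu>"
abbreviation "r \<equiv> rstar \<mu> \<nu>"
abbreviation "d \<equiv> dstar \<mu> \<nu>"
abbreviation "p \<equiv> pstar \<mu> \<nu>"
abbreviation "L \<equiv> lin_op \<mu> \<nu>"

text \<open>Ratios of neighbouring stationary weights, moving away from 0 to the right and to the
  left respectively.\<close>

definition "q = r / (r + p0)"
definition "\<sigma> = d / (d + p0)"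

text \<open>Rationalised form of the definition, which covers \<open>\<mu> = 1\<close> as well.\<close>

lemma p0_eq: "p0 = 1 / (2 * (\<mu> * (\<nu> + 1/2) + sqrt (\<mu>\<^sup>2 * \<nu>\<^sup>2 + \<mu>\<^sup>2 * \<nu> + 1/4)))"
proof (cases "\<mu> = 1")
  case True
  have "1 * \<nu>\<^sup>2 + 1 * \<nu> + 1/4 = (\<nu> + 1/2)\<^sup>2" by (simp add: power2_eq_square algebra_simps)
  then show ?thesis using True nu by (simp add: p0star_def)
next
  case False
  define R where "R = sqrt (\<mu>\<^sup>2 * \<nu>\<^sup>2 + \<mu>\<^sup>2 * \<nu> + 1/4)"
  have "\<mu>\<^sup>2 * \<nu>\<^sup>2 + \<mu>\<^sup>2 * \<nu> + 1/4 \<ge> 0" using mu nu by simp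
  then have R2: "R\<^sup>2 = \<mu>\<^sup>2 * \<nu>\<^sup>2 + \<mu>\<^sup>2 * \<nu> + 1/4" by (simp add: R_def)
  have "R \<ge> 0" using mu nu by (simp add: R_def)
  then have pos: "\<mu> * (\<nu> + 1/2) + R > 0" using mu nu by (simp add: add_pos_nonneg)
  have "\<mu>\<^sup>2 \<noteq> 1" using False mu by (simp add: power2_eq_1_iff)
  moreover have "(\<mu> * (\<nu> + 1/2) - R) * (\<mu> * (\<nu> + 1/2) + R) = (\<mu>\<^sup>2 - 1) / 4"
    using R2 by (simp add: power2_eq_square algebra_simps)
  moreover have "(X - R) / (m / 2) = 1 / (2 * (X + R))"
    if "m \<noteq> 0" "X + R > 0" "(X - R) * (X + R) = m / 4" for X m :: real
    using that by (subst frac_eq_eq) auto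
  ultimately have "(\<mu> * (\<nu> + 1/2) - R) / ((\<mu>\<^sup>2 - 1) / 2) = 1 / (2 * (\<mu> * (\<nu> + 1/2) + R))"
    using pos by (metis right_minus_eq)
  then show ?thesis using False by (simp add: p0star_def R_def)
qed

text \<open>The second bound is positivity of \<open>d\<close> in disguise, as
  \<open>d = (1 - (\<mu> + 1) * p0) / 2\<close>; it holds because the square root in the
  rationalised denominator exceeds 1/2.\<close>

lemma p0_pos: "p0 > 0" and mu_p0_less: "(\<mu> + 1) * p0 < 1"
proof -
  have "sqrt ((1/2)\<^sup>2) < sqrt (\<mu>\<^sup>2 * \<nu>\<^sup>2 + \<mu>\<^sup>2 * \<nu> + 1/4)"
    using mu nu by (intro real_sqrt_less_mono) (simp add: power2_eq_square add_pos_pos)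
  then have *: "sqrt (\<mu>\<^sup>2 * \<nu>\<^sup>2 + \<mu>\<^sup>2 * \<nu> + 1/4) > 1/2" by simp
  have "0 < \<mu> * \<nu>" using mu nu by simp
  then have **: "\<mu> + 1 < 2 * (\<mu> * (\<nu> + 1/2) + sqrt (\<mu>\<^sup>2 * \<nu>\<^sup>2 + \<mu>\<^sup>2 * \<nu> + 1/4))"
    using * unfolding distrib_left by linarith
  then have "0 < 2 * (\<mu> * (\<nu> + 1/2) + sqrt (\<mu>\<^sup>2 * \<nu>\<^sup>2 + \<mu>\<^sup>2 * \<nu> + 1/4))" using mu by linarith
  then show "p0 > 0" "(\<mu> + 1) * p0 < 1" using ** unfolding p0_eq by simp_all
qed

lemma r_pos: "r > 0"
proof -
  have "(\<mu> - 1) * p0 + 1 = \<mu> * p0 + (1 - p0)" by (simp add: algebra_simps)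
  moreover have "\<mu> * p0 > 0" using mu p0_pos by simp
  moreover have "p0 < 1" using mu_p0_less \<open>\<mu> * p0 > 0\<close> by (simp add: algebra_simps)
  ultimately show ?thesis by (simp add: rstar_def)
qed

lemma d_pos: "d > 0"
proof -
  have "d = (1 - (\<mu> + 1) * p0) / 2" by (simp add: dstar_def rstar_def field_simps)
  then show ?thesis using mu_p0_less by simp
qed

lemma mass_eq_1: "r + p0 + d = 1"
  by (simp add: dstar_def)

lemma q_bounds: "0 < q" "q < 1" and \<sigma>_bounds: "0 < \<sigma>" "\<sigma> < 1"
  using r_pos d_pos p0_pos by (simp_all add: q_def \<sigma>_def)

lemma p_nonneg_eq: "n \<ge> 0 \<Longrightarrow> p n = p0 * q ^ nat n"
  by (simp add: pstar_def q_def power_int_def Let_def)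

lemma p_nonpos_eq: "n \<le> 0 \<Longrightarrow> p n = p0 * \<sigma> ^ nat (- n)"
  by (cases "n = 0") (simp_all add: pstar_def \<sigma>_def power_int_def Let_def)

lemma p_0: "p 0 = p0" by (simp add: p_nonneg_eq)

lemma p_pos: "p n > 0"
  using q_bounds \<sigma>_bounds p0_pos by (cases "n \<ge> 0") (simp_all add: p_nonneg_eq p_nonpos_eq)

lemma p_up: "n \<ge> 0 \<Longrightarrow> p (n + 1) = q * p n"
  by (simp add: p_nonneg_eq nat_add_distrib)

lemma p_down: "n \<le> 0 \<Longrightarrow> p (n - 1) = \<sigma> * p n"
  using nat_add_distrib[of "- n" 1] by (simp add: p_nonpos_eq)

lemma p_has_sum_right: "(p has_sum r) {1..}"
proof -
  have "(\<lambda>k. p0 * q * q ^ k) sums (p0 * q * (1 / (1 - q)))"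
    using q_bounds by (intro sums_mult geometric_sums) simp
  moreover have "p0 * q * (1 / (1 - q)) = r"
  proof -
    have "1 - q = p0 / (r + p0)" using r_pos p0_pos by (simp add: q_def diff_divide_eq_iff)
    then show ?thesis using r_pos p0_pos by (simp add: q_def)
  qed
  ultimately have "((\<lambda>k. p0 * q * q ^ k) has_sum r) UNIV"
    using q_bounds p0_pos by (intro sums_nonneg_imp_has_sum) auto
  then have "((\<lambda>k. p (int (Suc k))) has_sum r) UNIV"
    by (subst p_nonneg_eq) (auto simp: mult_ac nat_add_distrib)
  then show ?thesis by (simp only: has_sum_int_ge_1)
qed

lemma p_has_sum_left: "(p has_sum d) {..-1}"
proof -
  have "(\<lambda>k. p0 * \<sigma> * \<sigma> ^ k) sums (p0 * \<sigma> * (1 / (1 - \<sigma>)))"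
    using \<sigma>_bounds by (intro sums_mult geometric_sums) simp
  moreover have "p0 * \<sigma> * (1 / (1 - \<sigma>)) = d"
  proof -
    have "1 - \<sigma> = p0 / (d + p0)" using d_pos p0_pos by (simp add: \<sigma>_def diff_divide_eq_iff)
    then show ?thesis using d_pos p0_pos by (simp add: \<sigma>_def)
  qed
  ultimately have "((\<lambda>k. p0 * \<sigma> * \<sigma> ^ k) has_sum d) UNIV"
    using \<sigma>_bounds p0_pos by (intro sums_nonneg_imp_has_sum) auto
  then have "((\<lambda>k. p (- int (Suc k))) has_sum d) UNIV"
    by (subst p_nonpos_eq) (auto simp: mult_ac nat_add_distrib)
  then show ?thesis by (simp only: has_sum_int_le_m1)
qed

lemma p_has_sum: "(p has_sum 1) UNIV"
  using has_sum_split_int(3)[OF p_has_sum_right p_has_sum_left] mass_eq_1 by (simp add: p_0 add_ac)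

text \<open>Rate of the jump from \<open>n\<close> to \<open>n - 1\<close>; jumps to the right have
  rate \<open>q\<close> everywhere. The change of rate between 0 and 1 matches the change of ratio
  of \<open>p\<close>, which makes the walk reversible.\<close>

definition dn :: "int \<Rightarrow> real" where "dn n = (if n \<ge> 1 then 1 else q * \<sigma>)"

text \<open>\<open>G\<close> and \<open>H\<close> are the mean-field profiles multiplying
  \<open>\<alpha>\<close> and \<open>\<alpha> + \<beta>\<close>, divided by \<open>p\<close>; both
  are piecewise constant because \<open>p\<close> is geometric on each side.\<close>

definition G :: "int \<Rightarrow> real" where "G n = (if n \<ge> 1 then 1 - q else - q * (1 - \<sigma>))"

definition H :: "int \<Rightarrow> real" where
  "H n = (if n \<ge> 1 then 0 else if n = 0 then - q * \<sigma> else q * (1 - \<sigma>))"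

lemma dn_bounds: "0 \<le> dn n" "dn n \<le> 1"
  using q_bounds \<sigma>_bounds by (auto simp: dn_def mult_le_one)

lemma detailed_balance: "dn (n + 1) * p (n + 1) = q * p n"
proof (cases "n \<ge> 0")
  case True then show ?thesis by (simp add: dn_def p_up)
next
  case False then show ?thesis using p_down[of "n + 1"] by (simp add: dn_def)
qed

lemma abs_G_le: "\<bar>G n\<bar> \<le> 1"
  using q_bounds \<sigma>_bounds mult_le_one[of q "1 - \<sigma>"] by (auto simp: G_def abs_mult)

lemma abs_H_le: "\<bar>H n\<bar> \<le> 1"
  using q_bounds \<sigma>_bounds mult_le_one[of q "1 - \<sigma>"] mult_le_one[of q \<sigma>] by (auto simp: H_def abs_mult)

lemma lin_op_eq:
  "L w n = dn (n + 1) * w (n + 1) - (dn n + q) * w n + q * w (n - 1)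
     + p n * (lin_alpha \<mu> \<nu> w * G n + (lin_alpha \<mu> \<nu> w + lin_beta \<mu> \<nu> w) * H n)"
proof -
  have rd: "r * d / ((r + p0) * (d + p0)) = q * \<sigma>" by (simp add: q_def \<sigma>_def)
  have rd': "r * d * c * x / ((r + p0) * (d + p0)) = q * \<sigma> * c * x" for c x
    by (simp add: q_def \<sigma>_def)
  consider "n \<ge> 1" | "n = 0" | "n \<le> -1" by linarith
  then show ?thesis
  proof cases
    case 1
    then have "p n = q * p (n - 1)" using p_up[of "n - 1"] by simp
    then show ?thesis using 1
      unfolding lin_op_def Let_def q_def[symmetric] by (simp add: dn_def G_def H_def algebra_simps)
  next
    case 2
    have "p (-1) = \<sigma> * p0" using p_down[of 0] by (simp add: p_0)
    then show ?thesis using 2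
      unfolding lin_op_def Let_def q_def[symmetric] rd by (simp add: dn_def G_def H_def p_0 algebra_simps)
  next
    case 3
    then have "p (n - 1) = \<sigma> * p n" "p n = \<sigma> * p (n + 1)" using p_down[of n] p_down[of "n + 1"] by auto
    then show ?thesis using 3
      unfolding lin_op_def Let_def q_def[symmetric] rd rd' by (simp add: dn_def G_def H_def algebra_simps)
  qed
qed

section \<open>Boundedness of the operator in l1 and in weighted l2\<close>

definition "\<kappa>0 = 4 / r + 2 / d"

lemma \<kappa>0_nonneg: "\<kappa>0 \<ge> 0" using r_pos d_pos by (simp add: \<kappa>0_def)

lemma abs_mean_field_le:
  assumes w: "(\<lambda>n. \<bar>w n\<bar>) summable_on UNIV"
  shows "\<bar>lin_alpha \<mu> \<nu> w * G n + (lin_alpha \<mu> \<nu> w + lin_beta \<mu> \<nu> w) * H n\<bar> \<le> \<kappa>0 * (\<Sum>\<^sub>\<infinity>n. \<bar>w n\<bar>)"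
proof -
  let ?N = "\<Sum>\<^sub>\<infinity>n. \<bar>w n\<bar>"
  have part: "\<bar>infsum w A\<bar> \<le> ?N" for A
  proof -
    have A: "(\<lambda>n. \<bar>w n\<bar>) summable_on A" by (rule summable_on_subset_banach[OF w]) simp
    then have "\<bar>infsum w A\<bar> \<le> (\<Sum>\<^sub>\<infinity>n\<in>A. \<bar>w n\<bar>)" using norm_infsum_bound[of w A] by simp
    also have "\<dots> \<le> ?N" by (rule infsum_mono_neutral[OF A w]) auto
    finally show ?thesis .
  qed
  have N: "?N \<ge> 0" by (intro infsum_nonneg) simp
  have quot: "\<bar>x / a - y / (a + p0)\<bar> \<le> 2 / a * ?N" if "\<bar>x\<bar> \<le> ?N" "\<bar>y\<bar> \<le> ?N" "a > 0" for x y a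
  proof -
    have "\<bar>x / a - y / (a + p0)\<bar> \<le> \<bar>x\<bar> / a + \<bar>y\<bar> / (a + p0)"
      using that p0_pos abs_triangle_ineq4[of "x / a" "y / (a + p0)"] by simp
    also have "\<dots> \<le> ?N / a + ?N / a" using that p0_pos N by (intro add_mono frac_le) auto
    finally show ?thesis by simp
  qed
  have a: "\<bar>lin_alpha \<mu> \<nu> w\<bar> \<le> 2 / r * ?N" and b: "\<bar>lin_beta \<mu> \<nu> w\<bar> \<le> 2 / d * ?N"
    unfolding lin_alpha_def lin_beta_def by (intro quot part r_pos d_pos)+
  have "\<bar>lin_alpha \<mu> \<nu> w * G n + (lin_alpha \<mu> \<nu> w + lin_beta \<mu> \<nu> w) * H n\<bar>
      \<le> \<bar>lin_alpha \<mu> \<nu> w\<bar> * \<bar>G n\<bar> + (\<bar>lin_alpha \<mu> \<nu> w\<bar> + \<bar>lin_beta \<mu> \<nu> w\<bar>) * \<bar>H n\<bar>"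
    unfolding abs_mult[symmetric]
    by (intro order_trans[OF abs_triangle_ineq] add_mono order_refl)
      (simp add: abs_mult mult_right_mono)
  also have "\<dots> \<le> \<bar>lin_alpha \<mu> \<nu> w\<bar> * 1 + (\<bar>lin_alpha \<mu> \<nu> w\<bar> + \<bar>lin_beta \<mu> \<nu> w\<bar>) * 1"
    by (intro add_mono mult_left_mono abs_G_le abs_H_le) auto
  also have "\<dots> \<le> \<kappa>0 * ?N" using a b by (simp add: \<kappa>0_def algebra_simps)
  finally show ?thesis .
qed

text \<open>A single pointwise majorant serves both the l1 and the weighted l2 bound.\<close>

lemma abs_lin_op_le:
  assumes "(\<lambda>n. \<bar>w n\<bar>) summable_on UNIV"
  shows "\<bar>L w n\<bar> \<le> \<bar>w (n + 1)\<bar> + 2 * \<bar>w n\<bar> + \<bar>w (n - 1)\<bar> + \<kappa>0 * (\<Sum>\<^sub>\<infinity>n. \<bar>w n\<bar>) * p n"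
proof -
  have 1: "\<bar>dn (n + 1) * w (n + 1)\<bar> \<le> \<bar>w (n + 1)\<bar>" "\<bar>q * w (n - 1)\<bar> \<le> \<bar>w (n - 1)\<bar>"
    using dn_bounds q_bounds by (simp_all add: abs_mult mult_left_le_one_le)
  have 2: "\<bar>(dn n + q) * w n\<bar> \<le> 2 * \<bar>w n\<bar>"
    unfolding abs_mult using dn_bounds[of n] q_bounds by (intro mult_right_mono) auto
  have 3: "\<bar>p n * (lin_alpha \<mu> \<nu> w * G n + (lin_alpha \<mu> \<nu> w + lin_beta \<mu> \<nu> w) * H n)\<bar> \<le> \<kappa>0 * (\<Sum>\<^sub>\<infinity>n. \<bar>w n\<bar>) * p n"
    unfolding abs_mult[of "p n"]
    using mult_left_mono[OF abs_mean_field_le[OF assms, of n], of "p n"] p_pos[of n] by (simp add: mult_ac)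
  show ?thesis unfolding lin_op_eq using 1 2 3 by linarith
qed

lemma lin_op_l1_le:
  assumes w: "(\<lambda>n. \<bar>w n\<bar>) summable_on UNIV" and F: "finite F"
  shows "(\<Sum>n\<in>F. \<bar>L w n\<bar>) \<le> (4 + \<kappa>0) * (\<Sum>\<^sub>\<infinity>n. \<bar>w n\<bar>)"
proof -
  let ?N = "\<Sum>\<^sub>\<infinity>n. \<bar>w n\<bar>"
  have N: "((\<lambda>n. \<bar>w n\<bar>) has_sum ?N) UNIV" using w by (rule has_sum_infsum)
  have "((\<lambda>n. \<bar>w (n + 1)\<bar> + 2 * \<bar>w n\<bar> + \<bar>w (n + - 1)\<bar> + \<kappa>0 * ?N * p n) has_sum
      ?N + 2 * ?N + ?N + \<kappa>0 * ?N * 1) UNIV"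
    using N by (intro has_sum_add has_sum_cmult_right p_has_sum)
      (simp_all only: has_sum_shift_int[of "\<lambda>n. \<bar>w n\<bar>"])
  then have "(\<Sum>n\<in>F. \<bar>w (n + 1)\<bar> + 2 * \<bar>w n\<bar> + \<bar>w (n + - 1)\<bar> + \<kappa>0 * ?N * p n) \<le>
      ?N + 2 * ?N + ?N + \<kappa>0 * ?N * 1"
    using F \<kappa>0_nonneg less_imp_le[OF p_pos] has_sum_nonneg[OF N]
    by (elim finite_sum_le_has_sum) (auto intro!: add_nonneg_nonneg mult_nonneg_nonneg)
  moreover have "(\<Sum>n\<in>F. \<bar>L w n\<bar>) \<le> (\<Sum>n\<in>F. \<bar>w (n + 1)\<bar> + 2 * \<bar>w n\<bar> + \<bar>w (n + - 1)\<bar> + \<kappa>0 * ?N * p n)"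
    using abs_lin_op_le[OF w] by (intro sum_mono) simp
  ultimately show ?thesis by (simp add: algebra_simps)
qed

definition "\<Lambda> = 1 / q + 1 / \<sigma>"

lemma \<Lambda>_ge_1: "\<Lambda> \<ge> 1"
proof -
  have "1 \<le> 1 / q" "0 \<le> 1 / \<sigma>" using q_bounds \<sigma>_bounds by simp_all
  then show ?thesis unfolding \<Lambda>_def by linarith
qed

lemma p_ratio: "p (n + 1) \<le> \<Lambda> * p n" "p n \<le> \<Lambda> * p (n + 1)"
proof -
  have q\<Lambda>: "1 / q \<le> \<Lambda>" "1 / \<sigma> \<le> \<Lambda>" using q_bounds \<sigma>_bounds by (simp_all add: \<Lambda>_def)
  have "p (n + 1) \<le> \<Lambda> * p n \<and> p n \<le> \<Lambda> * p (n + 1)"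
  proof (cases "n \<ge> 0")
    case True
    then have e: "p (n + 1) = q * p n" "p n = 1 / q * p (n + 1)" using q_bounds by (simp_all add: p_up)
    have "q * p n \<le> \<Lambda> * p n" using q_bounds \<Lambda>_ge_1 p_pos[of n] by (intro mult_right_mono) auto
    moreover have "1 / q * p (n + 1) \<le> \<Lambda> * p (n + 1)"
      using q\<Lambda> p_pos[of "n + 1"] by (intro mult_right_mono) auto
    ultimately show ?thesis unfolding e[symmetric] by blast
  next
    case False
    then have e: "p n = \<sigma> * p (n + 1)" "p (n + 1) = 1 / \<sigma> * p n"
      using \<sigma>_bounds p_down[of "n + 1"] by simp_all
    have "\<sigma> * p (n + 1) \<le> \<Lambda> * p (n + 1)" using \<sigma>_bounds \<Lambda>_ge_1 p_pos[of "n + 1"] by (intro mult_right_mono) auto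
    moreover have "1 / \<sigma> * p n \<le> \<Lambda> * p n"
      using q\<Lambda> p_pos[of n] by (intro mult_right_mono) auto
    ultimately show ?thesis unfolding e[symmetric] by blast
  qed
  then show "p (n + 1) \<le> \<Lambda> * p n" "p n \<le> \<Lambda> * p (n + 1)" by auto
qed

definition "\<kappa>1 = 8 * \<Lambda> + 16 + 4 * \<kappa>0\<^sup>2"

lemma \<kappa>1_pos: "\<kappa>1 > 0" using \<Lambda>_ge_1 by (simp add: \<kappa>1_def add_pos_nonneg)

text \<open>Covers \<open>1 / p\<close> and its truncations with common constants. The bound by
  \<open>1 / p\<close> controls the mean-field part, since then \<open>a n * (p n)^2\<close> is at
  most \<open>p n\<close>; comparability of neighbours controls the shifts.\<close>

definition admissible_weight :: "(int \<Rightarrow> real) \<Rightarrow> bool" where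
  "admissible_weight a \<longleftrightarrow>
    (\<forall>n. 0 \<le> a n \<and> a n \<le> 1 / p n \<and> a n \<le> \<Lambda> * a (n + 1) \<and> a (n + 1) \<le> \<Lambda> * a n)"

lemma inverse_p_le: "1 / p n \<le> \<Lambda> * (1 / p (n + 1))" "1 / p (n + 1) \<le> \<Lambda> * (1 / p n)"
  using p_ratio[of n] p_pos[of n] p_pos[of "n + 1"] by (simp_all add: field_simps)

lemma admissible_inverse_p: "admissible_weight (\<lambda>n. 1 / p n)"
  using inverse_p_le p_pos by (auto simp: admissible_weight_def less_imp_le)

lemma admissible_truncated: "k \<ge> 0 \<Longrightarrow> admissible_weight (\<lambda>n. min (1 / p n) k)"
proof -
  assume k: "k \<ge> 0"
  then have "k \<le> \<Lambda> * k" using \<Lambda>_ge_1 mult_right_mono[of 1 \<Lambda> k] by simp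
  moreover have "\<Lambda> * min x y = min (\<Lambda> * x) (\<Lambda> * y)" for x y
    using \<Lambda>_ge_1 by (simp add: min_mult_distrib_left)
  ultimately show ?thesis
    using inverse_p_le k p_pos unfolding admissible_weight_def
    by (auto simp: less_imp_le intro: min.coboundedI1 min.coboundedI2)
qed

text \<open>Squaring a four-term sum costs a factor 4, each shift a factor \<open>\<Lambda>\<close>,
  and the total mass of \<open>p\<close> is one; \<open>\<kappa>1\<close> collects these
  constants.\<close>

lemma lin_op_l2_le:
  assumes adm: "admissible_weight a"
    and w: "(\<lambda>n. \<bar>w n\<bar>) summable_on UNIV" and aw: "(\<lambda>n. a n * (w n)\<^sup>2) summable_on UNIV" and F: "finite F"
  shows "(\<Sum>n\<in>F. a n * (L w n)\<^sup>2) \<le> \<kappa>1 * ((\<Sum>\<^sub>\<infinity>n. a n * (w n)\<^sup>2) + (\<Sum>\<^sub>\<infinity>n. \<bar>w n\<bar>)\<^sup>2)"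
proof -
  let ?N = "\<Sum>\<^sub>\<infinity>n. \<bar>w n\<bar>" and ?A = "\<Sum>\<^sub>\<infinity>n. a n * (w n)\<^sup>2"
  let ?b = "\<lambda>n. 4 * \<Lambda> * (a (n + 1) * (w (n + 1))\<^sup>2) + 16 * (a n * (w n)\<^sup>2)
    + 4 * \<Lambda> * (a (n + - 1) * (w (n + - 1))\<^sup>2) + 4 * (\<kappa>0 * ?N)\<^sup>2 * p n"
  have a: "0 \<le> a n" "a n * p n \<le> 1" "a n \<le> \<Lambda> * a (n + 1)" "a n \<le> \<Lambda> * a (n + - 1)" for n
  proof -
    have b: "0 \<le> a m" "a m \<le> 1 / p m" "a m \<le> \<Lambda> * a (m + 1)" "a (m + 1) \<le> \<Lambda> * a m" for m
      using adm unfolding admissible_weight_def by blast+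
    show "0 \<le> a n" "a n \<le> \<Lambda> * a (n + 1)" using b by blast+
    show "a n * p n \<le> 1" using b(2)[of n] p_pos[of n] by (simp add: pos_le_divide_eq)
    show "a n \<le> \<Lambda> * a (n + - 1)" using b(4)[of "n - 1"] by simp
  qed
  have A: "((\<lambda>n. a n * (w n)\<^sup>2) has_sum ?A) UNIV" using aw by (rule has_sum_infsum)
  have le: "a n * (L w n)\<^sup>2 \<le> ?b n" for n
  proof -
    have sq: "(x + y + z + t)\<^sup>2 \<le> 4 * x\<^sup>2 + 4 * y\<^sup>2 + 4 * z\<^sup>2 + 4 * t\<^sup>2" for x y z t :: real
    proof -
      have "0 \<le> (x - y)\<^sup>2 + (x - z)\<^sup>2 + (x - t)\<^sup>2 + (y - z)\<^sup>2 + (y - t)\<^sup>2 + (z - t)\<^sup>2" by simp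
      then show ?thesis by (simp add: power2_eq_square algebra_simps)
    qed
    have "(L w n)\<^sup>2 \<le> (\<bar>w (n + 1)\<bar> + 2 * \<bar>w n\<bar> + \<bar>w (n - 1)\<bar> + \<kappa>0 * ?N * p n)\<^sup>2"
      using power_mono[OF abs_lin_op_le[OF w, of n], of 2] by simp
    also have "\<dots> \<le> 4 * \<bar>w (n + 1)\<bar>\<^sup>2 + 4 * (2 * \<bar>w n\<bar>)\<^sup>2 + 4 * \<bar>w (n - 1)\<bar>\<^sup>2 + 4 * (\<kappa>0 * ?N * p n)\<^sup>2"
      by (rule sq)
    also have "\<dots> = 4 * (w (n + 1))\<^sup>2 + 16 * (w n)\<^sup>2 + 4 * (w (n - 1))\<^sup>2 + 4 * (\<kappa>0 * ?N)\<^sup>2 * (p n)\<^sup>2"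
      by (simp add: power_mult_distrib)
    finally have "a n * (L w n)\<^sup>2 \<le> a n * (4 * (w (n + 1))\<^sup>2 + 16 * (w n)\<^sup>2 + 4 * (w (n - 1))\<^sup>2 + 4 * (\<kappa>0 * ?N)\<^sup>2 * (p n)\<^sup>2)"
      using a(1) by (rule mult_left_mono)
    also have "\<dots> = 4 * (a n * (w (n + 1))\<^sup>2) + 16 * (a n * (w n)\<^sup>2) + 4 * (a n * (w (n + - 1))\<^sup>2)
        + 4 * (\<kappa>0 * ?N)\<^sup>2 * (a n * p n * p n)"
      by (simp add: algebra_simps power2_eq_square)
    also have "\<dots> \<le> 4 * (\<Lambda> * a (n + 1) * (w (n + 1))\<^sup>2) + 16 * (a n * (w n)\<^sup>2)
        + 4 * (\<Lambda> * a (n + - 1) * (w (n + - 1))\<^sup>2) + 4 * (\<kappa>0 * ?N)\<^sup>2 * (1 * p n)"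
      using p_pos[of n] by (intro add_mono mult_left_mono mult_right_mono a) (auto simp: less_imp_le)
    finally show ?thesis by (simp add: mult_ac)
  qed
  have "(?b has_sum 4 * \<Lambda> * ?A + 16 * ?A + 4 * \<Lambda> * ?A + 4 * (\<kappa>0 * ?N)\<^sup>2 * 1) UNIV"
    using A by (intro has_sum_add has_sum_cmult_right p_has_sum)
      (simp_all only: has_sum_shift_int[of "\<lambda>n. a n * (w n)\<^sup>2"])
  then have "sum ?b F \<le> 4 * \<Lambda> * ?A + 16 * ?A + 4 * \<Lambda> * ?A + 4 * (\<kappa>0 * ?N)\<^sup>2 * 1"
    using F order_trans[OF _ le] a(1) by (elim finite_sum_le_has_sum) auto
  moreover have "(\<Sum>n\<in>F. a n * (L w n)\<^sup>2) \<le> sum ?b F" by (intro sum_mono le)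
  moreover have "4 * \<Lambda> * ?A + 16 * ?A + 4 * \<Lambda> * ?A + 4 * (\<kappa>0 * ?N)\<^sup>2 * 1 \<le> \<kappa>1 * (?A + ?N\<^sup>2)"
  proof -
    have "?A \<ge> 0" using a(1) by (intro infsum_nonneg) simp
    then show ?thesis using \<Lambda>_ge_1 by (simp add: \<kappa>1_def power_mult_distrib algebra_simps)
  qed
  ultimately show ?thesis by linarith
qed

subsection \<open>Entropy dissipation\<close>

definition "\<rho> = r\<^sup>2 / (2 * r + p0)"
definition "\<delta> = d\<^sup>2 / (2 * d + p0)"
text \<open>\<open>K\<^sub>r\<close> and \<open>K\<^sub>l\<close> are the coefficients of
  \<open>R^2\<close> and \<open>D^2\<close> in the mean-field contribution to the
  dissipation.\<close>

definition "K\<^sub>r = 1 / r + q * \<sigma> / (d + p0)"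
definition "K\<^sub>l = q * (1 / d + 1 / (r + p0))"

lemma \<rho>_pos: "\<rho> > 0" and \<delta>_pos: "\<delta> > 0"
  using r_pos d_pos p0_pos by (simp_all add: \<rho>_def \<delta>_def)

lemma K_pos: "K\<^sub>r > 0" "K\<^sub>l > 0"
  using r_pos d_pos p0_pos q_bounds \<sigma>_bounds
  by (auto simp: K\<^sub>r_def K\<^sub>l_def intro!: add_pos_nonneg mult_pos_pos add_pos_pos)

text \<open>Inverts the change of variables: total mass one gives the linear system
  \<open>r = q * (1 - d)\<close>, \<open>d = \<sigma> * (1 - r)\<close>.\<close>

lemma params_eq:
  "p0 = (1 - q) * (1 - \<sigma>) / (1 - q * \<sigma>)" "r = q * (1 - \<sigma>) / (1 - q * \<sigma>)" "d = (1 - q) * \<sigma> / (1 - q * \<sigma>)"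
  and q\<sigma>_less: "q * \<sigma> < 1"
proof -
  have rq: "r = q * (r + p0)" and d\<sigma>: "d = \<sigma> * (d + p0)" using r_pos d_pos p0_pos by (simp_all add: q_def \<sigma>_def)
  have "r + p0 = 1 - d" "d + p0 = 1 - r" using mass_eq_1 by linarith+
  then have r': "r = q * (1 - d)" and d': "d = \<sigma> * (1 - r)" using rq d\<sigma> by metis+
  have "q * \<sigma> < 1 * 1" using q_bounds \<sigma>_bounds by (intro mult_strict_mono) auto
  then show qs: "q * \<sigma> < 1" by simp
  have "r * (1 - q * \<sigma>) = q * (1 - \<sigma>)" using r' d' by algebra
  then show r: "r = q * (1 - \<sigma>) / (1 - q * \<sigma>)" using qs by (simp add: eq_divide_eq)
  have "d * (1 - q * \<sigma>) = (1 - q) * \<sigma>" using r' d' by algebra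
  then show d: "d = (1 - q) * \<sigma> / (1 - q * \<sigma>)" using qs by (simp add: eq_divide_eq)
  have "p0 * (1 - q * \<sigma>) = (1 - q) * (1 - \<sigma>)" using r' d' mass_eq_1 by algebra
  then show "p0 = (1 - q) * (1 - \<sigma>) / (1 - q * \<sigma>)" using qs by (simp add: eq_divide_eq)
qed

text \<open>Identifies the quotient occurring in \<open>C3\<close> and in gamma with the constant of
  the first-moment inequality at ratio \<open>q\<close>.\<close>

lemma \<rho>_eq: "\<rho> = p0 * q\<^sup>2 / ((1 - q) * (1 + q))" and \<rho>_r: "\<rho> / r = q / (1 + q)"
proof -
  have "(2 * r + p0) * q = r * (1 + q)" "r * (1 - q) = p0 * q"
    using r_pos p0_pos by (simp_all add: q_def field_simps)
  then have "r / (2 * r + p0) = q / (1 + q)" and pr: "p0 * q / (1 - q) = r"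
    using r_pos p0_pos q_bounds by (simp_all add: frac_eq_eq mult_ac eq_divide_eq divide_eq_eq)
  then show "\<rho> / r = q / (1 + q)" using r_pos by (simp add: \<rho>_def power2_eq_square)
  then have "\<rho> = r * (q / (1 + q))" using r_pos by (simp add: divide_eq_eq mult.commute)
  then show "\<rho> = p0 * q\<^sup>2 / ((1 - q) * (1 + q))" unfolding pr[symmetric] by (simp add: power2_eq_square)
qed

lemma \<delta>_eq: "\<delta> = p0 * \<sigma>\<^sup>2 / ((1 - \<sigma>) * (1 + \<sigma>))"
proof -
  have "(2 * d + p0) * \<sigma> = d * (1 + \<sigma>)" "d * (1 - \<sigma>) = p0 * \<sigma>"
    using d_pos p0_pos by (simp_all add: \<sigma>_def field_simps)
  then have "d / (2 * d + p0) = \<sigma> / (1 + \<sigma>)" and pr: "p0 * \<sigma> / (1 - \<sigma>) = d"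
    using d_pos p0_pos \<sigma>_bounds by (simp_all add: frac_eq_eq mult_ac eq_divide_eq divide_eq_eq)
  then have "\<delta> = d * (\<sigma> / (1 + \<sigma>))" unfolding \<delta>_def power2_eq_square by (metis times_divide_eq_right)
  then show ?thesis unfolding pr[symmetric] by (simp add: power2_eq_square)
qed

text \<open>The first and last summands of \<open>C3\<close> belong to the right mass, the two
  middle ones to the left mass.\<close>

lemma C3_eq: "C3 \<mu> \<nu> = \<rho> * K\<^sub>r + \<delta> * K\<^sub>l"
proof -
  have "r / (2 * r + p0) = \<rho> * (1 / r)" using r_pos by (simp add: \<rho>_def power2_eq_square)
  moreover have "r * d\<^sup>2 / ((2 * d + p0) * (r + p0)\<^sup>2) = \<delta> * (q * (1 / (r + p0)))"
    by (simp add: \<delta>_def q_def power2_eq_square)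
  moreover have "r * d / ((r + p0) * (2 * d + p0)) = \<delta> * (q * (1 / d))"
    using d_pos by (simp add: \<delta>_def q_def power2_eq_square mult_ac)
  moreover have "r ^ 3 * d / ((r + p0) * (2 * r + p0) * (d + p0)\<^sup>2) = \<rho> * (q * \<sigma> / (d + p0))"
    by (simp add: \<rho>_def q_def \<sigma>_def power2_eq_square power3_eq_cube mult_ac)
  ultimately show ?thesis
    unfolding C3_def Let_def K\<^sub>r_def K\<^sub>l_def distrib_left by simp
qed

lemma C3_gt: "C3 \<mu> \<nu> > q / (1 + q)"
proof -
  have "\<rho> * K\<^sub>r = q / (1 + q) + \<rho> * (q * \<sigma> / (d + p0))"
    unfolding K\<^sub>r_def distrib_left using \<rho>_r by simp
  moreover have "\<rho> * (q * \<sigma> / (d + p0)) > 0" "\<delta> * K\<^sub>l > 0"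
    using \<rho>_pos \<delta>_pos K_pos q_bounds \<sigma>_bounds d_pos p0_pos by simp_all
  ultimately show ?thesis unfolding C3_eq by linarith
qed

lemma C1_eq: "C1 \<mu> \<nu> = 1 - q * \<sigma> - C3 \<mu> \<nu>"
  unfolding C1_def C3_def Let_def q_def \<sigma>_def by simp

lemma sqrt_quotient: "a > 0 \<Longrightarrow> b > 0 \<Longrightarrow> (sqrt b - sqrt a) / sqrt b = 1 - sqrt (a / b)"
  by (simp add: real_sqrt_divide diff_divide_distrib)

lemma C2_eq: "C2 \<mu> \<nu> = max ((1 - sqrt q)\<^sup>2) (q * (1 - sqrt \<sigma>)\<^sup>2)"
  and C4_eq: "C4 \<mu> \<nu> = min ((1 - sqrt q)\<^sup>2) (q * (1 - sqrt \<sigma>)\<^sup>2)"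
  using r_pos d_pos p0_pos by (simp_all add: C2_def C4_def Let_def sqrt_quotient q_def \<sigma>_def)

lemma gamma_eq: "gamma_const \<mu> \<nu> = (\<rho> + \<delta>) / (p0 + \<rho> + \<delta>)"
  by (simp add: gamma_const_def Let_def \<rho>_def \<delta>_def)

text \<open>Both entries of the minimum \<open>C4\<close> exceed q/(1+q), the first summand of
  \<open>C3\<close>. Since (1 - sqrt x)^2 is at most 1 - x, the left entry gives \<sigma> < q/(1+q)
  and the right one q/(1+q) < 1 - q.\<close>

lemma \<sigma>_le_of_C4: "C4 \<mu> \<nu> > C3 \<mu> \<nu> \<Longrightarrow> \<sigma> \<le> 1 - q"
proof -
  assume "C4 \<mu> \<nu> > C3 \<mu> \<nu>"
  then have a: "(1 - sqrt q)\<^sup>2 > q / (1 + q)" and b: "q * (1 - sqrt \<sigma>)\<^sup>2 > q / (1 + q)"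
    using C3_gt unfolding C4_eq by linarith+
  have le: "(1 - sqrt x)\<^sup>2 \<le> 1 - x" if "0 < x" "x < 1" for x
  proof -
    have "sqrt x * sqrt x \<le> 1 * sqrt x" using that by (intro mult_right_mono) auto
    then have "x \<le> sqrt x" using that by simp
    then show ?thesis using that by (simp add: power2_diff)
  qed
  have "q * (1 / (1 + q)) < q * (1 - sqrt \<sigma>)\<^sup>2" using b by simp
  then have "1 / (1 + q) < (1 - sqrt \<sigma>)\<^sup>2" using q_bounds by (simp only: mult_less_cancel_left_pos)
  then have "1 / (1 + q) < 1 - \<sigma>" using le[OF \<sigma>_bounds] by linarith
  moreover have "1 / (1 + q) + q / (1 + q) = 1" using q_bounds by (simp add: add_divide_distrib[symmetric])
  moreover have "q / (1 + q) < 1 - q" using a le[OF q_bounds] by linarith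
  ultimately show ?thesis by linarith
qed

text \<open>The mean-field contribution to the dissipation, as a quadratic form in the right and left
  masses \<open>R\<close> and \<open>D\<close>; \<open>\<sigma> \<le> 1 - q\<close> makes the mixed term absorbable.\<close>

lemma mean_field_form_le:
  assumes \<sigma>q: "\<sigma> \<le> 1 - q" and R: "R\<^sup>2 \<le> \<rho> * Ep" and D: "D\<^sup>2 \<le> \<delta> * Em"
  defines "\<alpha> \<equiv> R / r + D / (r + p0)" and "\<beta> \<equiv> D / d + R / (d + p0)"
  shows "\<alpha> * (1 - q * \<sigma>) * R + (\<alpha> + \<beta>) * (q * (D + \<sigma> * R)) \<le> C3 \<mu> \<nu> * (Ep + Em)"
proof -
  define k where "k = (1 - q * \<sigma>)\<^sup>2 / ((1 - \<sigma>) * (1 - q))"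
  define z where "z = 1 - q * \<sigma>"
  have z: "z > 0" "1 - q > 0" "1 - \<sigma> > 0" using q\<sigma>_less q_bounds \<sigma>_bounds by (auto simp: z_def)
  have rp: "r + p0 = (1 - \<sigma>) / z" and dp: "d + p0 = (1 - q) / z"
    and rz: "r = q * (1 - \<sigma>) / z" and dz: "d = (1 - q) * \<sigma> / z"
  proof -
    show r: "r = q * (1 - \<sigma>) / z" and d: "d = (1 - q) * \<sigma> / z" using params_eq by (simp_all add: z_def)
    have "p0 = (1 - q) * (1 - \<sigma>) / z" using params_eq by (simp add: z_def)
    then show "r + p0 = (1 - \<sigma>) / z" "d + p0 = (1 - q) / z"
      unfolding r d by (simp_all add: add_divide_distrib[symmetric]) (simp_all add: algebra_simps)
  qed
  have Ap: "K\<^sub>r = z / (q * (1 - \<sigma>)) + q * \<sigma> * z / (1 - q)"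
    unfolding K\<^sub>r_def dp rz by simp
  have Am: "K\<^sub>l = q * (z / ((1 - q) * \<sigma>) + z / (1 - \<sigma>))"
    unfolding K\<^sub>l_def rp dz by simp
  have Am': "K\<^sub>l = q * z\<^sup>2 / ((1 - q) * \<sigma> * (1 - \<sigma>))"
    unfolding Am using z \<sigma>_bounds by (simp add: divide_simps power2_eq_square) (simp add: z_def algebra_simps)
  define a b where "a = z / (1 - \<sigma>)" and "b = z * q / (1 - q)"
  have form: "\<alpha> * (1 - q * \<sigma>) * R + (\<alpha> + \<beta>) * (q * (D + \<sigma> * R)) = K\<^sub>r * R\<^sup>2 + 2 * k * R * D + K\<^sub>l * D\<^sup>2"
  proof -
    have \<alpha>: "\<alpha> = a * (R / q + D)" unfolding \<alpha>_def rp unfolding a_def rz by (simp add: distrib_left add_divide_distrib mult_ac)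
    have \<beta>: "q * \<beta> = b * (D / \<sigma> + R)" unfolding \<beta>_def dp unfolding b_def dz by (simp add: distrib_left add_divide_distrib mult_ac)
    have k: "k = a + b"
      unfolding k_def a_def b_def z_def[symmetric] using z by (simp add: add_frac_eq power2_eq_square) (simp add: z_def algebra_simps)
    have K: "K\<^sub>r = a / q + b * \<sigma>" "K\<^sub>l = q * a + b / \<sigma>"
      unfolding Ap Am a_def b_def by (simp_all add: algebra_simps)
    have lhs: "\<alpha> * (1 - q * \<sigma>) * R + (\<alpha> + \<beta>) * (q * (D + \<sigma> * R)) = \<alpha> * (R + q * D) + q * \<beta> * (D + \<sigma> * R)"
      by (simp add: algebra_simps)
    show ?thesis
      unfolding lhs unfolding \<beta> \<alpha> k K using q_bounds \<sigma>_bounds by (simp add: field_simps power2_eq_square)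
  qed
  \<comment> \<open>In the variables R/sqrt \<rho> and D/sqrt \<delta> the form has trace
    \<open>C3\<close>, and this inequality says that its determinant is nonnegative, so the largest
    eigenvalue is at most the trace. The first summand of \<open>K\<^sub>r\<close> already
    suffices.\<close>
  have k2: "k\<^sup>2 \<le> K\<^sub>r * K\<^sub>l"
  proof -
    have "\<sigma> * z \<le> 1 - q" using \<sigma>q q_bounds \<sigma>_bounds
      by (smt (verit) mult_left_le mult_pos_pos z_def)
    have "k\<^sup>2 = z ^ 3 / ((1 - \<sigma>)\<^sup>2 * (1 - q)) * (z / (1 - q))"
      unfolding k_def z_def[symmetric] by (simp add: power2_eq_square power3_eq_cube mult_ac)
    also have "\<dots> \<le> z ^ 3 / ((1 - \<sigma>)\<^sup>2 * (1 - q)) * (1 / \<sigma>)"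
      using \<open>\<sigma> * z \<le> 1 - q\<close> z \<sigma>_bounds by (intro mult_left_mono) (simp_all add: field_simps)
    also have "\<dots> = z / (q * (1 - \<sigma>)) * K\<^sub>l"
      unfolding Am' using q_bounds by (simp add: power2_eq_square power3_eq_cube mult_ac)
    also have "\<dots> \<le> K\<^sub>r * K\<^sub>l"
      unfolding Ap using K_pos z q_bounds \<sigma>_bounds by (intro mult_right_mono) auto
    finally show ?thesis .
  qed
  \<comment> \<open>The weights are those for which \<open>R^2\<close> and \<open>D^2\<close>, once
    replaced by \<open>\<rho> * Ep\<close> and \<open>\<delta> * Em\<close>, both carry the full
    coefficient \<open>C3\<close>.\<close>
  have young: "2 * k * R * D \<le> \<delta> * K\<^sub>l / \<rho> * R\<^sup>2 + \<rho> * K\<^sub>r / \<delta> * D\<^sup>2"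
  proof -
    define B where "B = \<delta> * K\<^sub>l / \<rho>"
    have B: "B > 0" using \<rho>_pos \<delta>_pos K_pos by (simp add: B_def)
    have "0 \<le> (B * R - k * D)\<^sup>2" by simp
    then have "B * (2 * k * R * D) \<le> B * (B * R\<^sup>2) + k\<^sup>2 * D\<^sup>2"
      by (simp add: power2_eq_square algebra_simps)
    also have "\<dots> \<le> B * (B * R\<^sup>2) + K\<^sub>r * K\<^sub>l * D\<^sup>2" using k2 by (simp add: mult_right_mono)
    also have "\<dots> = B * (B * R\<^sup>2 + \<rho> * K\<^sub>r / \<delta> * D\<^sup>2)"
      using \<rho>_pos \<delta>_pos by (simp add: B_def field_simps)
    finally show ?thesis using B unfolding B_def[symmetric] by (simp only: mult_le_cancel_left_pos)
  qed
  have "\<alpha> * (1 - q * \<sigma>) * R + (\<alpha> + \<beta>) * (q * (D + \<sigma> * R)) \<le>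
      K\<^sub>r * R\<^sup>2 + \<delta> * K\<^sub>l / \<rho> * R\<^sup>2 + (K\<^sub>l * D\<^sup>2 + \<rho> * K\<^sub>r / \<delta> * D\<^sup>2)"
    unfolding form using young by linarith
  also have "\<dots> \<le> (K\<^sub>r * (\<rho> * Ep) + \<delta> * K\<^sub>l / \<rho> * (\<rho> * Ep)) + (K\<^sub>l * (\<delta> * Em) + \<rho> * K\<^sub>r / \<delta> * (\<delta> * Em))"
    using R D \<rho>_pos \<delta>_pos K_pos by (intro add_mono mult_left_mono) (auto simp: less_imp_le)
  also have "\<dots> = C3 \<mu> \<nu> * (Ep + Em)"
    unfolding C3_eq using \<rho>_pos \<delta>_pos by (simp add: algebra_simps)
  finally show ?thesis .
qed

text \<open>AM-GM balanced by the ratio of \<open>p\<close> across the edge, so that both endpoint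
  entropies get the same factor. The edge from 0 to 1 counts as right, the edge from -1 to 0 as
  left. Subtracting these factors from the diagonal 1 + q or q + q \<sigma> completes the squares (1
  - sqrt q)^2 and q (1 - sqrt \<sigma>)^2.\<close>

lemma edge_term_le:
  defines "b \<equiv> \<lambda>n::int. if n \<ge> 0 then sqrt q else q * sqrt \<sigma>"
  shows "dn (n + 1) * v (n + 1) * v n / p n \<le> b n / 2 * ((v n)\<^sup>2 / p n + (v (n + 1))\<^sup>2 / p (n + 1))"
proof -
  have amgm: "x * y / a \<le> sqrt k / 2 * (x\<^sup>2 / a + y\<^sup>2 / (k * a))" if "k > 0" "a > 0" for x y k a :: real
  proof -
    have "0 \<le> (sqrt k * x - y)\<^sup>2" by simp
    then have "2 * sqrt k * (x * y) \<le> k * x\<^sup>2 + y\<^sup>2"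
      using that by (simp add: power2_diff power_mult_distrib mult_ac)
    then have "sqrt k * (2 * sqrt k * (x * y)) \<le> sqrt k * (k * x\<^sup>2 + y\<^sup>2)"
      using that by (intro mult_left_mono) auto
    moreover have "sqrt k * (2 * sqrt k * (x * y)) = 2 * k * (x * y)"
      using that by (simp add: mult.assoc[symmetric] mult.commute[of "sqrt k" 2]) 
    ultimately have "2 * k * (x * y) / (2 * k * a) \<le> sqrt k * (k * x\<^sup>2 + y\<^sup>2) / (2 * k * a)"
      using that by (intro divide_right_mono) auto
    moreover have "2 * k * (x * y) / (2 * k * a) = x * y / a" using that by simp
    moreover have "sqrt k * (k * x\<^sup>2 + y\<^sup>2) / (2 * k * a) = sqrt k / 2 * (x\<^sup>2 / a + y\<^sup>2 / (k * a))"
      using that by (simp add: field_simps)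
    ultimately show ?thesis by linarith
  qed
  show ?thesis
  proof (cases "n \<ge> 0")
    case True
    then show ?thesis using amgm[OF q_bounds(1) p_pos[of n], of "v n" "v (n + 1)"]
      by (simp add: b_def dn_def p_up mult_ac)
  next
    case False
    then have pn: "p n = \<sigma> * p (n + 1)" using p_down[of "n + 1"] by simp
    then have pn': "1 / \<sigma> * p n = p (n + 1)" using \<sigma>_bounds by simp
    have s: "\<sigma> * sqrt (1 / \<sigma>) = sqrt \<sigma>"
      using \<sigma>_bounds by (simp add: real_sqrt_divide real_div_sqrt)
    have "v n * v (n + 1) / p n \<le> sqrt (1 / \<sigma>) / 2 * ((v n)\<^sup>2 / p n + (v (n + 1))\<^sup>2 / p (n + 1))"
      using amgm[of "1 / \<sigma>" "p n" "v n" "v (n + 1)"] \<sigma>_bounds p_pos unfolding pn' by simp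
    then have "q * \<sigma> * (v n * v (n + 1) / p n) \<le> q * \<sigma> * (sqrt (1 / \<sigma>) / 2 * ((v n)\<^sup>2 / p n + (v (n + 1))\<^sup>2 / p (n + 1)))"
      using q_bounds \<sigma>_bounds by (intro mult_left_mono) auto
    also have "\<dots> = q * (\<sigma> * sqrt (1 / \<sigma>)) / 2 * ((v n)\<^sup>2 / p n + (v (n + 1))\<^sup>2 / p (n + 1))"
      by simp
    finally show ?thesis using False unfolding s by (simp add: b_def dn_def mult_ac)
  qed
qed

section \<open>The dissipation inequality\<close>

definition "\<theta> = C4 \<mu> \<nu> - C3 \<mu> \<nu> - gamma_const \<mu> \<nu> * (C1 \<mu> \<nu> - C2 \<mu> \<nu>) * of_bool (C1 \<mu> \<nu> > C2 \<mu> \<nu>)"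

text \<open>Bounds the share of the entropy sitting at 0, where the component is -R-D.
  Cauchy-Schwarz gives (R+D)^2 at most (\<rho>+\<delta>)(Ep+Em); adding the term at 0 to both sides
  turns the quotient (\<rho>+\<delta>)/p0 into gamma.\<close>

lemma half_entropy_bound:
  assumes "Ep \<ge> 0" "Em \<ge> 0" and R: "R\<^sup>2 \<le> \<rho> * Ep" and D: "D\<^sup>2 \<le> \<delta> * Em"
  shows "(R + D)\<^sup>2 / p0 \<le> gamma_const \<mu> \<nu> * (Em + (R + D)\<^sup>2 / p0 + Ep)"
proof -
  have "(R + D)\<^sup>2 * (\<rho> * \<delta>) \<le> (\<rho> + \<delta>) * (\<delta> * R\<^sup>2 + \<rho> * D\<^sup>2)"
  proof -
    have "0 \<le> (\<delta> * R - \<rho> * D)\<^sup>2" by simp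
    then show ?thesis by (simp add: power2_eq_square algebra_simps)
  qed
  also have "\<dots> \<le> (\<rho> + \<delta>) * (\<delta> * (\<rho> * Ep) + \<rho> * (\<delta> * Em))"
    using R D \<rho>_pos \<delta>_pos by (intro mult_left_mono add_mono) auto
  also have "\<dots> = (\<rho> + \<delta>) * (Ep + Em) * (\<rho> * \<delta>)" by (simp add: algebra_simps)
  finally have le: "(R + D)\<^sup>2 \<le> (\<rho> + \<delta>) * (Ep + Em)" using \<rho>_pos \<delta>_pos by simp
  define x where "x = (R + D)\<^sup>2 / p0"
  have x: "p0 * x \<le> (\<rho> + \<delta>) * (Ep + Em)" using le p0_pos by (simp add: x_def)
  have "x * (p0 + \<rho> + \<delta>) \<le> (\<rho> + \<delta>) * (Em + x + Ep)" using x by (simp add: algebra_simps)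
  then have "x \<le> (\<rho> + \<delta>) * (Em + x + Ep) / (p0 + \<rho> + \<delta>)"
    using p0_pos \<rho>_pos \<delta>_pos by (subst pos_le_divide_eq) auto
  then show ?thesis unfolding gamma_eq x_def by simp
qed

lemma entropy_dissipation:
  assumes \<theta>: "\<theta> > 0" and v: "v \<in> V_space" and ev: "(\<lambda>n. 1 / p n * (v n)\<^sup>2) summable_on UNIV"
  shows "(\<Sum>\<^sub>\<infinity>n. 1 / p n * v n * L v n) \<le> - \<theta> * (\<Sum>\<^sub>\<infinity>n. 1 / p n * (v n)\<^sup>2)"
proof -
  define e where "e n = 1 / p n * (v n)\<^sup>2" for n
  define R D Ep Em where "R = infsum v {1..}" and "D = infsum v {..-1}"
    and "Ep = infsum e {1..}" and "Em = infsum e {..-1}"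
  have es: "e summable_on A" for A unfolding e_def by (rule summable_on_subset_banach[OF ev]) simp
  have e0: "e n \<ge> 0" for n using p_pos[of n] by (simp add: e_def)
  have Ep: "(e has_sum Ep) {1..}" and Em: "(e has_sum Em) {..-1}"
    unfolding Ep_def Em_def by (intro has_sum_infsum es)+
  have nn: "Ep \<ge> 0" "Em \<ge> 0" unfolding Ep_def Em_def by (intro infsum_nonneg e0)+
  have abs: "(\<lambda>n. \<bar>v n\<bar>) summable_on UNIV" and v0: "(v has_sum 0) UNIV"
    and m0: "((\<lambda>n. of_int n * v n) has_sum 0) UNIV" and ml: "((\<lambda>n. of_int n * v n) has_sum 0) {..0}"
    using v by (auto simp: V_space_def)
  have vs: "v summable_on A" for A
    by (rule summable_on_subset_banach[OF has_sum_imp_summable[OF v0]]) simp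
  have R: "(v has_sum R) {1..}" and D: "(v has_sum D) {..-1}"
    unfolding R_def D_def by (intro has_sum_infsum vs)+
  have vz: "v 0 = - R - D"
    using has_sum_unique[OF has_sum_split_int(3)[OF R D] v0] by simp
  have mr: "((\<lambda>n. of_int n * v n) has_sum 0) {1..}"
  proof -
    have "(\<lambda>n. of_int n * v n) summable_on {1..}"
      by (rule summable_on_subset_banach[OF has_sum_imp_summable[OF m0]]) simp
    then obtain x where x: "((\<lambda>n. of_int n * v n) has_sum x) {1..}" by (auto simp: summable_on_def)
    have "((\<lambda>n. of_int n * v n) has_sum 0 + x) ({..0} \<union> {1..})"
      by (rule has_sum_Un_disjoint[OF ml x]) auto
    moreover have "{..0} \<union> {1..} = (UNIV :: int set)" by auto
    ultimately have "x = 0" using has_sum_unique[OF m0] by simp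
    then show ?thesis using x by simp
  qed
  have ml': "((\<lambda>n. of_int n * v n) has_sum 0) {..-1}"
    by (rule has_sum_cong_neutral[THEN iffD1, OF _ _ _ ml]) auto
  have R2: "R\<^sup>2 \<le> \<rho> * Ep"
    unfolding \<rho>_eq
  proof (rule sum_sq_le_of_first_moment_zero[OF q_bounds p0_pos])
    show "((\<lambda>k. v (int (Suc k))) has_sum R) UNIV" using R by (subst has_sum_int_ge_1)
    show "((\<lambda>k. real (Suc k) * v (int (Suc k))) has_sum 0) UNIV"
      using mr by (subst (asm) has_sum_int_ge_1[symmetric]) simp
    show "((\<lambda>k. (v (int (Suc k)))\<^sup>2 / (p0 * q ^ Suc k)) has_sum Ep) UNIV"
      using Ep by (subst (asm) has_sum_int_ge_1[symmetric])
        (simp add: e_def p_nonneg_eq nat_add_distrib)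
  qed
  have D2: "D\<^sup>2 \<le> \<delta> * Em"
    unfolding \<delta>_eq
  proof (rule sum_sq_le_of_first_moment_zero[OF \<sigma>_bounds p0_pos])
    show "((\<lambda>k. v (- int (Suc k))) has_sum D) UNIV" using D by (subst has_sum_int_le_m1)
    have "((\<lambda>k. (- 1) * (of_int (- int (Suc k)) * v (- int (Suc k)))) has_sum (- 1) * 0) UNIV"
      by (rule has_sum_cmult_right) (use ml' in \<open>simp only: has_sum_int_le_m1[of "\<lambda>n. of_int n * v n"]\<close>)
    then show "((\<lambda>k. real (Suc k) * v (- int (Suc k))) has_sum 0) UNIV" by (simp add: algebra_simps)
    have "p (- int (Suc k)) = p0 * \<sigma> ^ Suc k" for k by (subst p_nonpos_eq) (auto simp: nat_add_distrib)
    then show "((\<lambda>k. (v (- int (Suc k)))\<^sup>2 / (p0 * \<sigma> ^ Suc k)) has_sum Em) UNIV"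
      using Em by (subst (asm) has_sum_int_le_m1[symmetric]) (simp add: e_def)
  qed
  define \<alpha> \<beta> where "\<alpha> = R / r + D / (r + p0)" and "\<beta> = D / d + R / (d + p0)"
  have \<alpha>: "lin_alpha \<mu> \<nu> v = \<alpha>" and \<beta>: "lin_beta \<mu> \<nu> v = \<beta>"
  proof -
    \<comment> \<open>Total mass zero: the sum over each half-line containing 0 is minus the mass of
      the opposite open half-line, so \<open>\<alpha>\<close> and \<open>\<beta>\<close> depend on
      \<open>R\<close> and \<open>D\<close> only.\<close>
    have "infsum v {0..} = - D" "infsum v {..0} = - R"
      using infsumI[OF has_sum_split_int(1)[OF R D]] infsumI[OF has_sum_split_int(2)[OF R D]] vz by simp_all
    then show "lin_alpha \<mu> \<nu> v = \<alpha>" "lin_beta \<mu> \<nu> v = \<beta>"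
      by (simp_all add: lin_alpha_def lin_beta_def R_def[symmetric] D_def[symmetric] \<alpha>_def \<beta>_def)
  qed
  define b where "b n = (if n \<ge> 0 then sqrt q else q * sqrt \<sigma>)" for n :: int
  \<comment> \<open>\<open>X n\<close> and \<open>Y n\<close> are the shares of site
    \<open>n\<close> in the bounds for the edges to its right and to its left. Each edge occurs
    twice, once from either endpoint, which yields the four shifted terms in \<open>?U\<close>. Only
    at site 0 do the two coefficients differ.\<close>
  define X Y Z where "X n = b n / 2 * e n" and "Y n = b (n + - 1) / 2 * e n" and "Z n = (dn n + q) * e n" for n
  have X: "(X has_sum q * sqrt \<sigma> / 2 * Em + sqrt q / 2 * e 0 + sqrt q / 2 * Ep) UNIV"
    using has_sum_piecewise[OF Ep Em, of "sqrt q / 2" "sqrt q / 2" "q * sqrt \<sigma> / 2"]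
    by (rule has_sum_cong[THEN iffD1, rotated]) (auto simp: X_def b_def)
  have Y: "(Y has_sum q * sqrt \<sigma> / 2 * Em + q * sqrt \<sigma> / 2 * e 0 + sqrt q / 2 * Ep) UNIV"
    using has_sum_piecewise[OF Ep Em, of "sqrt q / 2" "q * sqrt \<sigma> / 2" "q * sqrt \<sigma> / 2"]
    by (rule has_sum_cong[THEN iffD1, rotated]) (auto simp: Y_def b_def)
  have Z: "(Z has_sum (q * \<sigma> + q) * Em + (q * \<sigma> + q) * e 0 + (1 + q) * Ep) UNIV"
    using has_sum_piecewise[OF Ep Em, of "1 + q" "q * \<sigma> + q" "q * \<sigma> + q"]
    by (rule has_sum_cong[THEN iffD1, rotated]) (auto simp: Z_def dn_def)
  have Gs: "((\<lambda>n. G n * v n) has_sum - q * (1 - \<sigma>) * D + - q * (1 - \<sigma>) * v 0 + (1 - q) * R) UNIV"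
    using has_sum_piecewise[OF R D, of "1 - q" "- q * (1 - \<sigma>)" "- q * (1 - \<sigma>)"]
    by (rule has_sum_cong[THEN iffD1, rotated]) (auto simp: G_def)
  have Hs: "((\<lambda>n. H n * v n) has_sum q * (1 - \<sigma>) * D + - q * \<sigma> * v 0 + 0 * R) UNIV"
    using has_sum_piecewise[OF R D, of 0 "- q * \<sigma>" "q * (1 - \<sigma>)"]
    by (rule has_sum_cong[THEN iffD1, rotated]) (auto simp: H_def)
  let ?U = "\<lambda>n. X n + Y (n + 1) + X (n + - 1) + Y n + (- 1) * Z n + \<alpha> * (G n * v n) + (\<alpha> + \<beta>) * (H n * v n)"
  have U: "(?U has_sum
      (q * sqrt \<sigma> / 2 * Em + sqrt q / 2 * e 0 + sqrt q / 2 * Ep) + (q * sqrt \<sigma> / 2 * Em + q * sqrt \<sigma> / 2 * e 0 + sqrt q / 2 * Ep)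
      + (q * sqrt \<sigma> / 2 * Em + sqrt q / 2 * e 0 + sqrt q / 2 * Ep) + (q * sqrt \<sigma> / 2 * Em + q * sqrt \<sigma> / 2 * e 0 + sqrt q / 2 * Ep)
      + (- 1) * ((q * \<sigma> + q) * Em + (q * \<sigma> + q) * e 0 + (1 + q) * Ep)
      + \<alpha> * (- q * (1 - \<sigma>) * D + - q * (1 - \<sigma>) * v 0 + (1 - q) * R)
      + (\<alpha> + \<beta>) * (q * (1 - \<sigma>) * D + - q * \<sigma> * v 0 + 0 * R)) UNIV" (is "(_ has_sum ?SU) UNIV")
    by (intro has_sum_add has_sum_cmult_right Gs Hs Z)
      (simp_all only: has_sum_shift_int[of Y] has_sum_shift_int[of X] X Y)
  let ?T = "\<lambda>n. 1 / p n * v n * L v n"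
  have TU: "?T n \<le> ?U n" for n
  proof -
    have "?T n = dn (n + 1) * v (n + 1) * v n / p n + q * v (n - 1) * v n / p n - Z n
        + \<alpha> * (G n * v n) + (\<alpha> + \<beta>) * (H n * v n)"
      unfolding lin_op_eq \<alpha> \<beta> Z_def e_def using p_pos[of n]
      by (simp add: field_simps power2_eq_square)
    moreover have "dn (n + 1) * v (n + 1) * v n / p n \<le> X n + Y (n + 1)"
      using edge_term_le[of n v] unfolding X_def Y_def b_def e_def by (simp add: distrib_left)
    moreover have "q * v (n - 1) * v n / p n \<le> X (n + - 1) + Y n"
    proof -
      \<comment> \<open>Detailed balance turns the inflow from \<open>n - 1\<close> into the term of
        the edge starting at \<open>n - 1\<close>.\<close>
      have "q / p n = dn n / p (n - 1)"
        using detailed_balance[of "n - 1"] p_pos[of n] p_pos[of "n - 1"] by (simp add: frac_eq_eq mult.commute)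
      then have "q * v (n - 1) * v n / p n = dn n * v n * v (n - 1) / p (n - 1)"
        by (metis (no_types) mult.assoc mult.commute times_divide_eq_left)
      then show ?thesis
        using edge_term_le[of "n - 1" v] unfolding X_def Y_def b_def e_def by (simp add: distrib_left)
    qed
    ultimately show ?thesis by linarith
  qed
  have Ts: "?T summable_on UNIV"
  proof (rule summable_on_weighted_product[OF _ ev])
    show "0 \<le> 1 / p n" for n using p_pos[of n] by simp
    show "(\<lambda>n. 1 / p n * (L v n)\<^sup>2) summable_on UNIV"
      using p_pos by (intro nonneg_summable_infsum_le(1)[OF _ lin_op_l2_le[OF admissible_inverse_p abs ev]])
        (auto simp: less_imp_le)
  qed
  have "infsum ?T UNIV \<le> ?SU"
    by (rule has_sum_mono[OF has_sum_infsum[OF Ts] U TU])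
  define Q where "Q = \<alpha> * (1 - q * \<sigma>) * R + (\<alpha> + \<beta>) * (q * (D + \<sigma> * R))"
  have sq: "(sqrt q)\<^sup>2 = q" "(sqrt \<sigma>)\<^sup>2 = \<sigma>" using q_bounds \<sigma>_bounds by simp_all
  \<comment> \<open>The squares complete away from 0. In the mean-field part
    \<open>v 0 = - R - D\<close> eliminates the centre and leaves the form \<open>Q\<close>.\<close>
  have SU: "?SU = - (1 - sqrt q)\<^sup>2 * Ep - q * (1 - sqrt \<sigma>)\<^sup>2 * Em
      + (sqrt q + q * sqrt \<sigma> - q - q * \<sigma>) * e 0 + Q"
    unfolding vz Q_def by (simp add: power2_diff sq algebra_simps)
  have g: "gamma_const \<mu> \<nu> \<ge> 0" using \<rho>_pos \<delta>_pos p0_pos by (simp add: gamma_eq)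
  define c where "c = (C1 \<mu> \<nu> - C2 \<mu> \<nu>) * of_bool (C1 \<mu> \<nu> > C2 \<mu> \<nu>)"
  have c: "c \<ge> 0" "c \<ge> C1 \<mu> \<nu> - C2 \<mu> \<nu>" by (auto simp: c_def)
  have \<theta>c: "\<theta> = C4 \<mu> \<nu> - C3 \<mu> \<nu> - gamma_const \<mu> \<nu> * c" by (simp add: \<theta>_def c_def)
  have "C4 \<mu> \<nu> > C3 \<mu> \<nu>" using \<theta> mult_nonneg_nonneg[OF g c(1)] unfolding \<theta>c by linarith
  then have Q: "Q \<le> C3 \<mu> \<nu> * (Ep + Em)"
    unfolding Q_def \<alpha>_def \<beta>_def by (intro mean_field_form_le \<sigma>_le_of_C4 R2 D2)
  have C4: "C4 \<mu> \<nu> * Ep \<le> (1 - sqrt q)\<^sup>2 * Ep" "C4 \<mu> \<nu> * Em \<le> q * (1 - sqrt \<sigma>)\<^sup>2 * Em"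
    using nn by (auto simp: C4_eq intro!: mult_right_mono)
  \<comment> \<open>The deficit of site 0 against the rate \<open>C4 - C3\<close>. As max plus min
    is the sum of both entries, comparison with \<open>C1 - C2\<close> reduces to q (1 + \<sigma> -
    sqrt \<sigma>) at most sqrt q.\<close>
  have "C4 \<mu> \<nu> - C3 \<mu> \<nu> + (sqrt q + q * sqrt \<sigma> - q - q * \<sigma>) \<le> c"
  proof -
    have "sqrt q * (1 + \<sigma> - sqrt \<sigma>) \<le> 1 * 1"
    proof (rule mult_mono)
      have "sqrt \<sigma> * sqrt \<sigma> \<le> 1 * sqrt \<sigma>" using \<sigma>_bounds by (intro mult_right_mono) auto
      then show "1 + \<sigma> - sqrt \<sigma> \<le> 1" using \<sigma>_bounds by simp
      show "0 \<le> 1 + \<sigma> - sqrt \<sigma>" using \<sigma>_bounds real_sqrt_lt_1_iff[of \<sigma>] by linarith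
    qed (use q_bounds in auto)
    then have "sqrt q * (sqrt q * (1 + \<sigma> - sqrt \<sigma>)) \<le> sqrt q * 1"
      using q_bounds by (intro mult_left_mono) auto
    then have "q * (1 + \<sigma> - sqrt \<sigma>) \<le> sqrt q"
      using q_bounds by (simp add: mult.assoc[symmetric])
    moreover have "C2 \<mu> \<nu> + C4 \<mu> \<nu> = (1 - sqrt q)\<^sup>2 + q * (1 - sqrt \<sigma>)\<^sup>2"
      unfolding C2_eq C4_eq by (simp add: min_def max_def)
    ultimately have "C4 \<mu> \<nu> - C3 \<mu> \<nu> + (sqrt q + q * sqrt \<sigma> - q - q * \<sigma>) \<le> C1 \<mu> \<nu> - C2 \<mu> \<nu>"
      unfolding C1_eq by (simp add: power2_diff sq algebra_simps)
    then show ?thesis using c(2) by linarith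
  qed
  then have "(C4 \<mu> \<nu> - C3 \<mu> \<nu> + (sqrt q + q * sqrt \<sigma> - q - q * \<sigma>)) * e 0 \<le> c * e 0"
    using e0 by (intro mult_right_mono)
  moreover have "c * e 0 \<le> c * (gamma_const \<mu> \<nu> * (Em + e 0 + Ep))"
  proof (rule mult_left_mono[OF _ c(1)])
    have "e 0 = (R + D)\<^sup>2 / p0" unfolding e_def p_0 vz by (simp add: power2_eq_square algebra_simps add_divide_distrib)
    then show "e 0 \<le> gamma_const \<mu> \<nu> * (Em + e 0 + Ep)"
      using half_entropy_bound[OF nn R2 D2] by simp
  qed
  ultimately have "?SU \<le> - \<theta> * (Em + e 0 + Ep)"
    unfolding SU \<theta>c using Q C4 by (simp add: algebra_simps)
  moreover have "(\<Sum>\<^sub>\<infinity>n. 1 / p n * (v n)\<^sup>2) = Em + e 0 + Ep"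
    using infsumI[OF has_sum_split_int(3)[OF Ep Em]] unfolding e_def[symmetric] by simp
  ultimately show ?thesis using \<open>infsum ?T UNIV \<le> ?SU\<close> by simp
qed

end

subsection \<open>Solutions\<close>

locale walk_solution = walk +
  fixes w :: "real \<Rightarrow> int \<Rightarrow> real"
  assumes sol: "lin_solution \<mu> \<nu> w"
begin

lemma in_V: "t \<ge> 0 \<Longrightarrow> w t \<in> V_space"
  using sol by (simp add: lin_solution_def)

lemma abs_summable: "t \<ge> 0 \<Longrightarrow> (\<lambda>n. \<bar>w t n\<bar>) summable_on UNIV"
  using in_V by (simp add: V_space_def)

lemma has_derivative_component:
  "t \<ge> 0 \<Longrightarrow> ((\<lambda>s. w s n) has_real_derivative L (w t) n) (at t within {0..})"
  using sol by (simp add: lin_solution_def)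

lemma has_derivative_component_within:
  "0 \<le> a \<Longrightarrow> t \<in> {a..b} \<Longrightarrow> ((\<lambda>s. w s n) has_real_derivative L (w t) n) (at t within {a..b})"
  by (rule has_field_derivative_subset[OF has_derivative_component]) auto

section \<open>The l1 norm along a solution\<close>

definition N :: "real \<Rightarrow> real" where "N t = (\<Sum>\<^sub>\<infinity>n. \<bar>w t n\<bar>)"

lemma N_nonneg: "N t \<ge> 0"
  unfolding N_def by (intro infsum_nonneg) simp

lemma sum_le_N: "t \<ge> 0 \<Longrightarrow> finite F \<Longrightarrow> (\<Sum>n\<in>F. \<bar>w t n\<bar>) \<le> N t"
  unfolding N_def by (intro finite_sum_le_infsum abs_summable) auto

lemma N_le: "(\<And>F. finite F \<Longrightarrow> (\<Sum>n\<in>F. \<bar>w t n\<bar>) \<le> B) \<Longrightarrow> N t \<le> B"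
  unfolding N_def by (intro nonneg_summable_infsum_le(2)) auto

lemma l1_increment_le:
  assumes "0 \<le> s" "s \<le> t" "\<And>y. y \<in> {s..t} \<Longrightarrow> N y \<le> B" "finite F"
  shows "(\<Sum>n\<in>F. \<bar>w t n - w s n\<bar>) \<le> (t - s) * ((4 + \<kappa>0) * B)"
proof (rule sum_abs_increment_le[OF \<open>s \<le> t\<close> has_derivative_component_within[OF \<open>0 \<le> s\<close>]])
  fix \<tau> assume \<tau>: "\<tau> \<in> {s..t}"
  have "(\<Sum>n\<in>F. \<bar>L (w \<tau>) n\<bar>) \<le> (4 + \<kappa>0) * N \<tau>"
    unfolding N_def using assms(1) \<tau> by (intro lin_op_l1_le abs_summable \<open>finite F\<close>) auto
  also have "\<dots> \<le> (4 + \<kappa>0) * B" using assms(3)[OF \<tau>] \<kappa>0_nonneg by (intro mult_left_mono) auto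
  finally show "(\<Sum>n\<in>F. \<bar>L (w \<tau>) n\<bar>) \<le> (4 + \<kappa>0) * B" .
qed

text \<open>The window is so short that the increment is at most half the supremum \<open>B\<close>
  on the segment; finiteness of \<open>B\<close> is what allows absorbing it. The argument works in
  both time directions, as the Baire step requires.\<close>

lemma N_growth:
  assumes "0 \<le> s" "0 \<le> t" "\<bar>t - s\<bar> \<le> 1 / (2 * (4 + \<kappa>0))" and bdd: "bdd_above (N ` closed_segment s t)"
  shows "N t \<le> 2 * N s"
proof -
  let ?S = "closed_segment s t"
  have seg_iff: "y \<in> closed_segment x z \<longleftrightarrow> x \<le> y \<and> y \<le> z \<or> z \<le> y \<and> y \<le> x" for x y z :: real
    by (auto simp: closed_segment_eq_real_ivl)
  define B where "B = (SUP y\<in>?S. N y)"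
  have NB: "N y \<le> B" if "y \<in> ?S" for y unfolding B_def by (rule cSUP_upper[OF that bdd])
  have B: "B \<ge> 0" using NB[of s] N_nonneg[of s] by simp
  have "N y \<le> N s + B / 2" if y: "y \<in> ?S" for y
  proof (rule N_le)
    fix F :: "int set" assume F: "finite F"
    have yS: "s \<le> y \<and> y \<le> t \<or> t \<le> y \<and> y \<le> s" using y unfolding seg_iff .
    have "0 \<le> y" using yS assms(1,2) by arith
    have "(\<Sum>n\<in>F. \<bar>w y n - w s n\<bar>) \<le> \<bar>y - s\<bar> * ((4 + \<kappa>0) * B)"
    proof (cases "s \<le> y")
      case True
      have "N x \<le> B" if "x \<in> {s..y}" for x
      proof (rule NB)
        have "s \<le> x \<and> x \<le> t \<or> t \<le> x \<and> x \<le> s" using that yS True by auto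
        then show "x \<in> ?S" unfolding seg_iff .
      qed
      from l1_increment_le[OF assms(1) True this F] show ?thesis using True by simp
    next
      case False
      have "N x \<le> B" if "x \<in> {y..s}" for x
      proof (rule NB)
        have "s \<le> x \<and> x \<le> t \<or> t \<le> x \<and> x \<le> s" using that yS False by auto
        then show "x \<in> ?S" unfolding seg_iff .
      qed
      from l1_increment_le[OF \<open>0 \<le> y\<close> _ this F] show ?thesis using False by (simp add: abs_minus_commute)
    qed
    also have "\<dots> \<le> 1 / (2 * (4 + \<kappa>0)) * ((4 + \<kappa>0) * B)"
    proof (rule mult_right_mono)
      show "\<bar>y - s\<bar> \<le> 1 / (2 * (4 + \<kappa>0))" using yS assms(3) by arith
    qed (use B \<kappa>0_nonneg in simp)
    also have "\<dots> = B / 2"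
    proof -
      have "1 / (2 * K) * (K * B) = B / 2" if "K > 0" for K :: real using that by simp
      then show ?thesis using \<kappa>0_nonneg by (metis add_pos_nonneg zero_less_numeral)
    qed
    finally have "(\<Sum>n\<in>F. \<bar>w y n - w s n\<bar>) \<le> B / 2" .
    moreover have "(\<Sum>n\<in>F. \<bar>w y n\<bar>) \<le> (\<Sum>n\<in>F. \<bar>w s n\<bar> + \<bar>w y n - w s n\<bar>)"
      by (intro sum_mono) linarith
    ultimately show "(\<Sum>n\<in>F. \<bar>w y n\<bar>) \<le> N s + B / 2"
      using sum_le_N[OF assms(1) F] by (simp add: sum.distrib)
  qed
  then have "B \<le> N s + B / 2" unfolding B_def by (intro cSUP_least) auto
  then show ?thesis using NB[of t] by simp
qed

lemma N_bounded: "bdd_above (N ` {0..T})"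
proof (rule bdd_above_of_growth[OF _ _ N_growth])
  show "0 < 1 / (2 * (4 + \<kappa>0))" using \<kappa>0_nonneg by simp
  show "closed {t. 0 \<le> t \<and> N t \<le> real m}" for m
  proof -
    \<comment> \<open>\<open>N\<close> is a supremum of continuous finite sums, hence lower
      semicontinuous, although its continuity is not known.\<close>
    have "{t. 0 \<le> t \<and> N t \<le> real m} = (\<Inter>F\<in>{F. finite F}. {t \<in> {0..}. (\<Sum>n\<in>F. \<bar>w t n\<bar>) \<le> real m})"
    proof (intro equalityI subsetI)
      fix t assume "t \<in> {t. 0 \<le> t \<and> N t \<le> real m}"
      then show "t \<in> (\<Inter>F\<in>{F. finite F}. {t \<in> {0..}. (\<Sum>n\<in>F. \<bar>w t n\<bar>) \<le> real m})"
        using order_trans[OF sum_le_N] by auto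
    next
      fix t assume t: "t \<in> (\<Inter>F\<in>{F. finite F}. {t \<in> {0..}. (\<Sum>n\<in>F. \<bar>w t n\<bar>) \<le> real m})"
      then have "0 \<le> t" by blast
      moreover have "N t \<le> real m" using t by (intro N_le) blast
      ultimately show "t \<in> {t. 0 \<le> t \<and> N t \<le> real m}" by simp
    qed
    moreover have "closed {t \<in> {0..}. (\<Sum>n\<in>F. \<bar>w t n\<bar>) \<le> real m}" for F
    proof (rule continuous_on_closed_Collect_le)
      have "continuous_on {0..} (\<lambda>t. w t n)" for n
        by (rule DERIV_continuous_on[OF has_derivative_component]) simp
      then show "continuous_on {0..} (\<lambda>t. \<Sum>n\<in>F. \<bar>w t n\<bar>)" by (intro continuous_intros)
    qed auto
    ultimately show ?thesis by (simp only:) (intro closed_INT ballI)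
  qed
qed

section \<open>Persistence of finite entropy and its decay\<close>

definition E :: "real \<Rightarrow> real" where "E t = (\<Sum>\<^sub>\<infinity>n. 1 / p n * (w t n)\<^sup>2)"
text \<open>A divergent series would make \<open>E\<close> zero by convention, so finiteness has to
  be tracked separately.\<close>

abbreviation "finite_E t \<equiv> (\<lambda>n. 1 / p n * (w t n)\<^sup>2) summable_on UNIV"

text \<open>The weights \<open>1/p\<close> are truncated at height \<open>k\<close>, so that the weighted
  norms are finite a priori; the resulting bound does not depend on \<open>k\<close>.\<close>

lemma finite_E_window:
  assumes s: "0 \<le> s" "s \<le> t" and short: "(t - s)\<^sup>2 * \<kappa>1 \<le> 1 / 4"
    and M: "\<And>y. y \<in> {s..t} \<Longrightarrow> N y \<le> M" and Es: "finite_E s" and y: "y \<in> {s..t}"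
  shows "finite_E y" "E y \<le> 4 * E s + M\<^sup>2"
proof -
  have M0: "0 \<le> M" using M[of s] s N_nonneg[of s] by fastforce
  have trunc: "(\<Sum>\<^sub>\<infinity>n. min (1 / p n) k * (w y n)\<^sup>2) \<le> 4 * E s + M\<^sup>2
      \<and> (\<lambda>n. min (1 / p n) k * (w y n)\<^sup>2) summable_on UNIV" if k: "k \<ge> 0" for k
  proof -
    define a where "a n = min (1 / p n) k" for n
    have adm: "admissible_weight a" unfolding a_def by (rule admissible_truncated[OF k])
    have a: "0 \<le> a n" "a n \<le> k" "a n \<le> 1 / p n" for n using k p_pos[of n] by (auto simp: a_def)
    let ?A = "\<lambda>x. \<Sum>\<^sub>\<infinity>n. a n * (w x n)\<^sup>2"
    \<comment> \<open>A priori bound: the truncated weight is at most \<open>k\<close>, and an l1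
      bound also bounds every component. It depends on \<open>k\<close> and serves only to make the
      supremum \<open>S\<close> below finite.\<close>
    have fin: "(\<Sum>n\<in>F. a n * (w x n)\<^sup>2) \<le> k * M * M" if "x \<in> {s..t}" "finite F" for x F
    proof -
      have x0: "0 \<le> x" using that s by auto
      have "\<bar>w x n\<bar> \<le> M" for n using sum_le_N[OF x0, of "{n}"] M[OF that(1)] by simp
      then have "a n * (w x n)\<^sup>2 \<le> k * M * \<bar>w x n\<bar>" for n
        using mult_mono[OF a(2)[of n] mult_right_mono[of "\<bar>w x n\<bar>" M "\<bar>w x n\<bar>"]] k
        by (simp add: power2_eq_square mult.assoc)
      then have "(\<Sum>n\<in>F. a n * (w x n)\<^sup>2) \<le> (\<Sum>n\<in>F. k * M * \<bar>w x n\<bar>)" by (intro sum_mono)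
      also have "\<dots> = k * M * (\<Sum>n\<in>F. \<bar>w x n\<bar>)" by (simp add: sum_distrib_left)
      also have "\<dots> \<le> k * M * M"
        using sum_le_N[OF x0 that(2)] M[OF that(1)] k M0 by (intro mult_left_mono) auto
      finally show ?thesis .
    qed
    have sm: "(\<lambda>n. a n * (w x n)\<^sup>2) summable_on UNIV" and A_le: "?A x \<le> k * M * M" if "x \<in> {s..t}" for x
      using nonneg_summable_infsum_le[of "\<lambda>n. a n * (w x n)\<^sup>2" "k * M * M"] fin[OF that] a by auto
    define S where "S = (SUP x\<in>{s..t}. ?A x)"
    have AS: "?A x \<le> S" if "x \<in> {s..t}" for x
      unfolding S_def using A_le by (intro cSUP_upper[OF that] bdd_aboveI2[of _ _ "k * M * M"])
    have S0: "0 \<le> S" using AS[of s] infsum_nonneg[of UNIV "\<lambda>n. a n * (w s n)\<^sup>2"] a s by fastforce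
    have As: "?A s \<le> E s"
      unfolding E_def using sm s Es a by (intro infsum_mono mult_right_mono) auto
    \<comment> \<open>On a window with \<open>(t - s)^2 * \<kappa>1\<close> at most 1/4 the
      increment has weighted square norm at most \<open>(S + M^2) / 4\<close>; the factor 2 from
      splitting the square leaves \<open>S / 2\<close>, which is absorbed.\<close>
    have "?A x \<le> 2 * E s + (S + M\<^sup>2) / 2" if x: "x \<in> {s..t}" for x
    proof (rule nonneg_summable_infsum_le(2))
      fix F :: "int set" assume F: "finite F"
      have inc: "(\<Sum>n\<in>F. a n * (w x n - w s n)\<^sup>2) \<le> (x - s)\<^sup>2 * (\<kappa>1 * (S + M\<^sup>2))"
      proof (rule sum_square_increment_le[OF _ a(1) has_derivative_component_within[OF s(1)]])
        fix \<tau> assume "\<tau> \<in> {s..x}"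
        then have \<tau>: "\<tau> \<in> {s..t}" "0 \<le> \<tau>" using x s by auto
        have "(\<Sum>n\<in>F. a n * (L (w \<tau>) n)\<^sup>2) \<le> \<kappa>1 * (?A \<tau> + (N \<tau>)\<^sup>2)"
          unfolding N_def by (rule lin_op_l2_le[OF adm abs_summable[OF \<tau>(2)] sm[OF \<tau>(1)] F])
        also have "\<dots> \<le> \<kappa>1 * (S + M\<^sup>2)"
          using AS[OF \<tau>(1)] M[OF \<tau>(1)] N_nonneg \<kappa>1_pos by (intro mult_left_mono add_mono power_mono) auto
        finally show "(\<Sum>n\<in>F. a n * (L (w \<tau>) n)\<^sup>2) \<le> \<kappa>1 * (S + M\<^sup>2)" .
      qed (use x in auto)
      have "(x - s)\<^sup>2 * \<kappa>1 \<le> 1 / 4"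
      proof -
        have "(x - s)\<^sup>2 \<le> (t - s)\<^sup>2" using x by (intro power_mono) auto
        then show ?thesis using short mult_right_mono[of "(x - s)\<^sup>2" "(t - s)\<^sup>2" \<kappa>1] \<kappa>1_pos by linarith
      qed
      then have "(x - s)\<^sup>2 * \<kappa>1 * (S + M\<^sup>2) \<le> 1 / 4 * (S + M\<^sup>2)"
        using S0 by (intro mult_right_mono) auto
      with inc have inc': "(\<Sum>n\<in>F. a n * (w x n - w s n)\<^sup>2) \<le> (S + M\<^sup>2) / 4"
        unfolding mult.assoc[symmetric] by linarith
      have "(\<Sum>n\<in>F. a n * (w x n)\<^sup>2) \<le> (\<Sum>n\<in>F. 2 * (a n * (w s n)\<^sup>2) + 2 * (a n * (w x n - w s n)\<^sup>2))"
      proof (rule sum_mono)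
        fix n
        have "(w x n)\<^sup>2 \<le> 2 * (w s n)\<^sup>2 + 2 * (w x n - w s n)\<^sup>2"
          using zero_le_power2[of "w x n - 2 * w s n"] by (simp add: power2_eq_square algebra_simps)
        from mult_left_mono[OF this a(1)[of n]]
        show "a n * (w x n)\<^sup>2 \<le> 2 * (a n * (w s n)\<^sup>2) + 2 * (a n * (w x n - w s n)\<^sup>2)"
          by (simp add: distrib_left mult_ac)
      qed
      also have "\<dots> = 2 * (\<Sum>n\<in>F. a n * (w s n)\<^sup>2) + 2 * (\<Sum>n\<in>F. a n * (w x n - w s n)\<^sup>2)"
        by (simp add: sum.distrib sum_distrib_left)
      also have "\<dots> \<le> 2 * E s + 2 * ((S + M\<^sup>2) / 4)"
        using inc' As finite_sum_le_infsum[OF sm[of s] F] a s by (intro add_mono mult_left_mono) fastforce+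
      finally show "(\<Sum>n\<in>F. a n * (w x n)\<^sup>2) \<le> 2 * E s + (S + M\<^sup>2) / 2" by linarith
    qed (use a in auto)
    then have "S \<le> 2 * E s + (S + M\<^sup>2) / 2" unfolding S_def using s by (intro cSUP_least) auto
    then have "?A y \<le> 4 * E s + M\<^sup>2" using AS[OF y] by (simp add: field_simps)
    then show ?thesis using sm[OF y] by (simp add: a_def)
  qed
  have "(\<Sum>n\<in>F. 1 / p n * (w y n)\<^sup>2) \<le> 4 * E s + M\<^sup>2" if F: "finite F" for F
  proof -
    \<comment> \<open>At least every \<open>1 / p n\<close> on \<open>F\<close>, so the truncation
      is inactive there.\<close>
    define k where "k = (\<Sum>n\<in>F. 1 / p n)"
    have k: "1 / p n \<le> k" if "n \<in> F" for n
      unfolding k_def using F that p_pos by (intro member_le_sum) (auto simp: less_imp_le)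
    have k0: "k \<ge> 0" unfolding k_def using p_pos by (intro sum_nonneg) (auto simp: less_imp_le)
    have "(\<Sum>n\<in>F. 1 / p n * (w y n)\<^sup>2) = (\<Sum>n\<in>F. min (1 / p n) k * (w y n)\<^sup>2)"
      using k by (intro sum.cong) (auto simp: min_absorb1)
    also have "\<dots> \<le> (\<Sum>\<^sub>\<infinity>n. min (1 / p n) k * (w y n)\<^sup>2)"
      using trunc[OF k0] F k0 p_pos by (intro finite_sum_le_infsum) (auto simp: less_imp_le)
    also have "\<dots> \<le> 4 * E s + M\<^sup>2" using trunc[OF k0] by simp
    finally show ?thesis .
  qed
  from nonneg_summable_infsum_le[OF _ this] show "finite_E y" "E y \<le> 4 * E s + M\<^sup>2"
    unfolding E_def using p_pos by (auto simp: less_imp_le)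
qed

lemma E_decay_window:
  assumes \<theta>: "\<theta> > 0" and s: "0 \<le> s" "s \<le> t" and short: "(t - s)\<^sup>2 * \<kappa>1 \<le> 1 / 4" and Es: "finite_E s"
  shows "finite_E t" "E t \<le> E s * exp (- (2 * \<theta>) * (t - s))"
proof -
  obtain M where "\<forall>y\<in>{0..t}. N y \<le> M" using N_bounded[of t] by (auto simp: bdd_above_def)
  then have M: "N y \<le> M" if "y \<in> {s..t}" for y using that s by auto
  have window: "finite_E y" "E y \<le> 4 * E s + M\<^sup>2" if "y \<in> {s..t}" for y
    by (rule finite_E_window[OF s short _ Es that], rule M, assumption)+
  show "finite_E t" using window(1)[of t] s by simp
  have L2: "(\<Sum>n\<in>F. 1 / p n * (L (w \<tau>) n)\<^sup>2) \<le> \<kappa>1 * ((4 * E s + M\<^sup>2) + M\<^sup>2)"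
    if \<tau>: "\<tau> \<in> {s..t}" and F: "finite F" for F \<tau>
  proof -
    have "(\<Sum>n\<in>F. 1 / p n * (L (w \<tau>) n)\<^sup>2) \<le> \<kappa>1 * (E \<tau> + (N \<tau>)\<^sup>2)"
      unfolding N_def E_def using \<tau> s
      by (intro lin_op_l2_le[OF admissible_inverse_p abs_summable window(1) F]) auto
    also have "\<dots> \<le> \<kappa>1 * ((4 * E s + M\<^sup>2) + M\<^sup>2)"
      using window(2)[OF \<tau>] M[OF \<tau>] N_nonneg \<kappa>1_pos by (intro mult_left_mono add_mono power_mono) auto
    finally show ?thesis .
  qed
  have pn: "0 \<le> 1 / p n" for n using p_pos[of n] by simp
  have dE: "(E has_real_derivative 2 * (\<Sum>\<^sub>\<infinity>n. 1 / p n * w x n * L (w x) n)) (at x within {s..t})"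
    if x: "x \<in> {s..t}" for x
    unfolding E_def
  proof (rule has_derivative_weighted_square_sum[OF pn has_derivative_component_within[OF s(1)] window(1) _ _ x])
    fix \<tau> assume "\<tau> \<in> {s..t}"
    note * = nonneg_summable_infsum_le[OF _ L2[OF this]]
    show "(\<lambda>n. 1 / p n * (L (w \<tau>) n)\<^sup>2) summable_on UNIV" using pn by (intro *(1)) simp
    show "(\<Sum>\<^sub>\<infinity>n. 1 / p n * (L (w \<tau>) n)\<^sup>2) \<le> \<kappa>1 * ((4 * E s + M\<^sup>2) + M\<^sup>2)" using pn by (intro *(2)) simp
  qed
  let ?f = "\<lambda>x. exp (2 * \<theta> * x) * E x"
  \<comment> \<open>Derivative of the entropy times the integrating factor; dissipation makes it
    nonpositive. The factor 2 in the rate comes from differentiating squares.\<close>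
  define f' where "f' x = exp (2 * \<theta> * x) * (2 * (\<Sum>\<^sub>\<infinity>n. 1 / p n * w x n * L (w x) n) + 2 * \<theta> * E x)" for x
  have "(?f has_real_derivative f' x) (at x within {s..t})" if "x \<in> {s..t}" for x
    unfolding f'_def by (auto intro!: derivative_eq_intros dE[OF that] simp: algebra_simps)
  then obtain x where x: "x \<in> {s..t}" "?f t - ?f s = f' x * (t - s)"
    using mvt_very_simple[OF s(2), of ?f "\<lambda>x h. f' x * h"] unfolding has_field_derivative_def by fastforce
  have "(\<Sum>\<^sub>\<infinity>n. 1 / p n * w x n * L (w x) n) \<le> - \<theta> * E x"
    unfolding E_def using x(1) s by (intro entropy_dissipation[OF \<theta> in_V window(1)]) auto
  then have "f' x \<le> 0" unfolding f'_def by (intro mult_nonneg_nonpos) auto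
  then have "?f t \<le> ?f s" using x(2) s mult_nonpos_nonneg[of "f' x" "t - s"] by linarith
  have e: "exp a * (exp b * x) = x * exp (a + b)" for a b x :: real by (simp add: exp_add)
  have "exp (- (2 * \<theta> * t)) * ?f t \<le> exp (- (2 * \<theta> * t)) * ?f s"
    using \<open>?f t \<le> ?f s\<close> by (rule mult_left_mono) simp
  moreover have "exp (- (2 * \<theta> * t)) * ?f t = E t" unfolding e by simp
  moreover have "exp (- (2 * \<theta> * t)) * ?f s = E s * exp (- (2 * \<theta>) * (t - s))"
    unfolding e by (simp add: algebra_simps)
  ultimately show "E t \<le> E s * exp (- (2 * \<theta>) * (t - s))" by simp
qed

text \<open>The admissible window length depends on \<open>\<kappa>1\<close> only, not on the
  entropy or the l1 bound, so finitely many equal windows reach \<open>t\<close>, and their decay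
  factors multiply without loss.\<close>

lemma E_decay:
  assumes \<theta>: "\<theta> > 0" and t: "t \<ge> 0" and E0: "finite_E 0"
  shows "finite_E t" "E t \<le> E 0 * exp (- (2 * \<theta>) * t)"
proof -
  \<comment> \<open>This makes both \<open>2 * h\<close> and \<open>2 * h * \<kappa>1\<close> at
    most 1, and their product gives the smallness condition on the window.\<close>
  obtain m :: nat where m: "real m > 2 * t * (\<kappa>1 + 1)" using reals_Archimedean2 by blast
  have "0 \<le> 2 * t * (\<kappa>1 + 1)" using t \<kappa>1_pos by simp
  then have m0: "real m > 0" using m by linarith
  define h where "h = t / real m"
  have h: "0 \<le> h" "real m * h = t" using t m0 by (simp_all add: h_def)
  have short: "h\<^sup>2 * \<kappa>1 \<le> 1 / 4"
  proof -
    have hk: "2 * h * (\<kappa>1 + 1) \<le> 1" using m m0 unfolding h_def by (simp add: field_simps)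
    have "(2 * h) * 1 \<le> 2 * h * (\<kappa>1 + 1)" "2 * h * \<kappa>1 \<le> 2 * h * (\<kappa>1 + 1)"
      using h(1) \<kappa>1_pos by (intro mult_left_mono; simp)+
    then have "2 * h \<le> 1" "2 * h * \<kappa>1 \<le> 1" using hk by linarith+
    then have "(2 * h) * (2 * h * \<kappa>1) \<le> 1 * 1" using h(1) \<kappa>1_pos by (intro mult_mono) auto
    then show ?thesis by (simp add: power2_eq_square)
  qed
  have "finite_E (real j * h) \<and> E (real j * h) \<le> E 0 * exp (- (2 * \<theta>) * (real j * h))" for j
  proof (induction j)
    case 0
    then show ?case using E0 by simp
  next
    case (Suc j)
    have step: "0 \<le> real j * h" "real j * h \<le> real (Suc j) * h"
      "(real (Suc j) * h - real j * h)\<^sup>2 * \<kappa>1 \<le> 1 / 4" and dh: "real (Suc j) * h - real j * h = h"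
      using h(1) short by (simp_all add: algebra_simps)
    note d = E_decay_window[OF \<theta> step conjunct1[OF Suc.IH]]
    have "E (real (Suc j) * h) \<le> E (real j * h) * exp (- (2 * \<theta>) * h)" using d(2) unfolding dh .
    also have "\<dots> \<le> E 0 * exp (- (2 * \<theta>) * (real j * h)) * exp (- (2 * \<theta>) * h)"
      using Suc.IH by (intro mult_right_mono) auto
    also have "\<dots> = E 0 * exp (- (2 * \<theta>) * (real (Suc j) * h))"
      by (simp add: mult.assoc exp_add[symmetric] algebra_simps)
    finally show ?case using d(1) by blast
  qed
  from this[of m] show "finite_E t" "E t \<le> E 0 * exp (- (2 * \<theta>) * t)" unfolding h(2) by auto
qed

section \<open>Passage to the extended-valued entropy\<close>

lemma lin_entropy_eq: "finite_E t \<Longrightarrow> lin_entropy \<mu> \<nu> (w t) = ennreal (E t)"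
proof -
  assume fE: "finite_E t"
  let ?f = "\<lambda>n. 1 / p n * (w t n)\<^sup>2"
  have nn: "0 \<le> ?f n" for n using p_pos[of n] by simp
  have "((\<lambda>n. ennreal (?f n)) has_sum ennreal (E t)) UNIV"
    unfolding has_sum_def E_def
  proof (rule Lim_transform_eventually)
    show "((\<lambda>F. ennreal (sum ?f F)) \<longlongrightarrow> ennreal (infsum ?f UNIV)) (finite_subsets_at_top UNIV)"
      using has_sum_infsum[OF fE] unfolding has_sum_def by (rule tendsto_ennrealI)
    show "\<forall>\<^sub>F F in finite_subsets_at_top UNIV. ennreal (sum ?f F) = (\<Sum>n\<in>F. ennreal (?f n))"
      using nn by (intro always_eventually allI) (simp add: sum_ennreal)
  qed
  then show ?thesis unfolding lin_entropy_def by (simp add: infsumI)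
qed

lemma lin_entropy_infinite: "\<not> finite_E t \<Longrightarrow> lin_entropy \<mu> \<nu> (w t) = \<infinity>"
proof (rule ccontr)
  assume inf: "\<not> finite_E t" and ne: "lin_entropy \<mu> \<nu> (w t) \<noteq> \<infinity>"
  let ?f = "\<lambda>n. 1 / p n * (w t n)\<^sup>2"
  have nn: "0 \<le> ?f n" for n using p_pos[of n] by simp
  obtain B where B: "lin_entropy \<mu> \<nu> (w t) = ennreal B" "0 \<le> B" using ne by (cases "lin_entropy \<mu> \<nu> (w t)") auto
  have "sum ?f F \<le> B" if "finite F" for F
  proof -
    have "ennreal (sum ?f F) = (\<Sum>n\<in>F. ennreal ((w t n)\<^sup>2 / p n))" using nn by (simp add: sum_ennreal)
    also have "\<dots> \<le> lin_entropy \<mu> \<nu> (w t)"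
      unfolding lin_entropy_def
      unfolding infsum_finite[OF that, symmetric]
      by (intro infsum_mono_neutral nonneg_summable_on_complete) auto
    finally show ?thesis using B by simp
  qed
  from nonneg_summable_infsum_le(1)[of ?f, OF nn this] show False using inf by blast
qed

lemma lin_entropy_decay:
  assumes "\<theta> > 0" "t \<ge> 0"
  shows "lin_entropy \<mu> \<nu> (w t) \<le> lin_entropy \<mu> \<nu> (w 0) * ennreal (exp (- (2 * \<theta>) * t))"
proof (cases "finite_E 0")
  case True
  have "E 0 \<ge> 0" unfolding E_def using p_pos by (intro infsum_nonneg) (simp add: less_imp_le)
  then show ?thesis
    unfolding lin_entropy_eq[OF True] lin_entropy_eq[OF E_decay(1)[OF assms True]]
    using E_decay(2)[OF assms True] by (simp add: ennreal_mult[symmetric])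
next
  case False
  \<comment> \<open>With infinite initial entropy the right side is infinite, the exponential factor
    being positive.\<close>
  then show ?thesis by (simp add: lin_entropy_infinite ennreal_top_mult)
qed

end

text \<open>The witness is the parameter pair with \<open>q = 1/4\<close> and \<open>\<sigma> = 1/10000\<close>, squares of rationals.\<close>

lemma G_set_nonempty: "(3332 / 9999, 2500 / 11106389) \<in> G_set"
proof -
  \<comment> \<open>At q = 1/4 the entries of the minimum balance for small \<sigma>, as (1 - sqrt
    q)^2 = q. A tiny \<sigma> brings \<open>C3\<close> close to 1/5, gamma to 1/16 and
    \<open>C1 - C2\<close> to 0.55, so \<open>\<theta>\<close> is about 0.01. Then
    \<open>\<mu>\<close> follows from \<open>\<mu> = 1 + (2 * r - 1) / p0\<close>, and
    \<open>\<nu>\<close> from the equation for \<open>p0\<close>.\<close>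
  define \<mu> \<nu> :: real where "\<mu> = 3332 / 9999" and "\<nu> = 2500 / 11106389"
  have "\<mu>\<^sup>2 * \<nu>\<^sup>2 + \<mu>\<^sup>2 * \<nu> + 1 / 4 = (40001 / 79998)\<^sup>2" by (simp add: \<mu>_def \<nu>_def power2_eq_square)
  then have sqrt_eq: "sqrt (\<mu>\<^sup>2 * \<nu>\<^sup>2 + \<mu>\<^sup>2 * \<nu> + 1 / 4) = 40001 / 79998" by simp
  have p0: "p0star \<mu> \<nu> = 9999 / 13333" unfolding p0star_def sqrt_eq by (simp add: \<mu>_def \<nu>_def power2_eq_square)
  have r: "rstar \<mu> \<nu> = 3333 / 13333" unfolding rstar_def p0 by (simp add: \<mu>_def)
  have d: "dstar \<mu> \<nu> = 1 / 13333" unfolding dstar_def p0 r by simp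
  interpret walk \<mu> \<nu> by unfold_locales (simp_all add: \<mu>_def \<nu>_def)
  have q: "q = 1 / 4" and \<sigma>: "\<sigma> = 1 / 10000" unfolding q_def \<sigma>_def p0 r d by simp_all
  have sq: "sqrt q = 1 / 2" "sqrt \<sigma> = 1 / 100"
    unfolding q \<sigma> by (simp_all add: real_sqrt_divide real_sqrt_unique)
  have C2: "C2 \<mu> \<nu> = 1 / 4" and C4: "C4 \<mu> \<nu> = 9801 / 40000"
    unfolding C2_eq C4_eq sq unfolding q by (simp_all add: power2_eq_square)
  have "\<theta> > 0"
    unfolding \<theta>_def C1_eq C2 C4 gamma_eq C3_eq \<rho>_def \<delta>_def K\<^sub>r_def K\<^sub>l_def q \<sigma> p0 r d
    by (simp add: power2_eq_square)
  then show ?thesis unfolding G_set_def \<mu>_def[symmetric] \<nu>_def[symmetric] using mu nu by (simp add: \<theta>_def)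
qed

theorem theorem2:
  shows "G_set \<noteq> {} \<and>
    (\<forall>(\<mu>, \<nu>)\<in>G_set. \<exists>\<kappa>::real. \<kappa> > 0 \<and>
      (\<forall>w :: real \<Rightarrow> int \<Rightarrow> real. lin_solution \<mu> \<nu> w \<longrightarrow>
        (\<forall>t::real. t \<ge> 0 \<longrightarrow>
          lin_entropy \<mu> \<nu> (w t) \<le> lin_entropy \<mu> \<nu> (w 0) * ennreal (exp (- \<kappa> * t)))))"
proof (intro conjI ballI, goal_cases)
  case 1
  show ?case using G_set_nonempty by blast
next
  case (2 x)
  obtain \<mu> \<nu> where x: "x = (\<mu>, \<nu>)" by (cases x)
  interpret walk \<mu> \<nu> using 2 by unfold_locales (auto simp: x G_set_def)
  have \<theta>: "\<theta> > 0" using 2 by (simp add: x G_set_def \<theta>_def)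
  have "lin_entropy \<mu> \<nu> (w t) \<le> lin_entropy \<mu> \<nu> (w 0) * ennreal (exp (- (2 * \<theta>) * t))"
    if "lin_solution \<mu> \<nu> w" "t \<ge> 0" for w t
  proof -
    interpret walk_solution \<mu> \<nu> w using that(1) by unfold_locales
    show ?thesis using \<theta> that(2) by (rule lin_entropy_decay)
  qed
  then show ?case unfolding x using \<theta> by (intro case_prodI exI[of _ "2 * \<theta>"]) auto
qed

end
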